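(* Fix $\rho\in(0,1)$ and all other primitives of the model described in the context. For any social welfare function $W$ that is continuously differentiable, strictly increasing in every agent's utility (with partial derivatives bounded above and bounded away from zero) and (weakly) satisfies the Pigou-Dalton Principle, equilibrium social welfare, viewed as a function of economic mobility $s\in(0,1)$, is: (i) strictly increasing in $s$ if economic mobility is sufficiently close to $0$ (i.e. there is $s_0\in(0,1)$ such that it is strictly increasing on $(0,s_0)$); and (ii) strictly decreasing in $s$ if economic mobility is sufficiently close to $1$ (i.e. there is $s_1\in(0,1)$ such that it is strictly decreasing on $(s_1,1)$).
   Context: Agents and earning potential. $n$ is a positive integer divisible by $4$, $N=\{1,\dots,n\}$. Each agent $i$ has ability $a_i\in\{H,L\}$ and background $b_i\in\{R,P\}$. The classes are $Q=\{HR,LR,HP,LP\}$ (ability, background); each contains $n/4$ agents; $a_q,b_q$ denote the ability and background of class $q$. $s\in[0,1]$ is economic mobility. An agent in class $q=(a,b)$ has earning potential $y_q=y(a,b,s)\in\mathbb{R}$, continuous in $s\in[0,1]$ and differentiable on $(0,1)$, with: (1) $\frac{dy_{HP}}{ds}=-\frac{dy_{LR}}{ds}>0$ and $\frac{dy_{HR}}{ds}=\frac{dy_{LP}}{ds}=0$ on $(0,1)$; (2) for each $b$, $y(H,b,s)>y(L,b,s)$ for $s\in(0,1)$ and $\lim_{s\to0}[y(H,b,s)-y(L,b,s)]=0$; for each $a$, $y(a,R,s)>y(a,P,s)$ for $s\in(0,1)$ and $\lim_{s\to1}[y(a,R,s)-y(a,P,s)]=0$. Network. $G$ is an $n\times n$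 matrix with $G_{ij}\ge0$, $G_{ii}=0$. There are $d>0$, $\omega\in(0,1)$, $\rho\in(0,1)$ ($\rho$ is called integration) such that for all classes $q,q'$ and all $i\in q$: $\sum_{j\in q'}G_{ij}=d\,g_{qq'}$, where $g_{qq'}=\omega$ if $q=q'$; $g_{qq'}=\rho(1-\omega)$ if $q\ne q'$ and $a_q=a_{q'}$; $g_{qq'}=(1-\rho)(1-\omega)$ if $q\neq q'$ and $b_q=b_{q'}$; $g_{qq'}=0$ otherwise. Game. All agents simultaneously choose $x_i\in[0,\infty)$; payoffs are $U_i=u(x_i,y_i)-\sum_{j:\,x_i\le x_j}G_{ij}F(x_j-x_i)$. $F:[0,\infty)\to\mathbb{R}$ is smooth, strictly increasing and strictly convex with $F(0)=F'(0)=0$. $u:[0,\infty)\times Y\to\mathbb{R}$ ($Y$ an open interval containing all earning potentials $[y_{LP},y_{HR}]$) is twice continuously differentiable; subscripts on $u$ denote partial derivatives; $x^a(y):=\arg\max_{x\ge0}u(x,y)$. Assumption: for all $x\ge0$ and all $y\in Y$: (i) $u_{xx}(x,y)<0$ and $x^a(y)$ exists and is interior ($x^a(y)>0$); (ii) $u_y(x,y)>0$; (iii) $u_{xy}(x,y)>0$ for $x>0$; (iv) $V(y):=\max_{x\ge0}u(x,y)$ is strictly concave. Equilibrium. The solution concept is (pure) Nash equilibrium. The game has a unique Nash equilibrium, in which all agents of a class $q$ choose the same consumption $x_q^*$; $U_i^*$ denotes agent $i$'s equilibrium payoff. Welfare. A social welfare function is a map $W:\mathbb{R}^n\to\mathbb{R}$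 of $(U_1,\dots,U_n)$, evaluated at $(U_1^*,\dots,U_n^* )$. It satisfies the (weak) Pigou-Dalton Principle if $W$ weakly increases under any transfer of utility from an agent with higher utility to one with lower utility that does not reverse the ordering of their utilities: if $U_i>U_j$, $\varepsilon>0$ and $U_i-\varepsilon\ge U_j+\varepsilon$, then replacing $(U_i,U_j)$ by $(U_i-\varepsilon,U_j+\varepsilon)$ does not decrease $W$. "Partial derivatives bounded above and bounded away from zero" means there are $0<\underline m\le\overline m<\infty$ with $\underline m\le\partial W/\partial U_i\le\overline m$ for all $i$ everywhere. *)

theory Defs
  imports "HOL-Analysis.Analysis"
begin

datatype ability = High | Low
datatype background = Rich | Poor

type_synonym agent_class = "ability \<times> background"

definition link_share :: "real \<Rightarrow> real \<Rightarrow> agent_class \<Rightarrow> agent_class \<Rightarrow> real" where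
  "link_share \<omega> \<rho> q q' =
     (if q = q' then \<omega>
      else if fst q = fst q' then \<rho> * (1 - \<omega>)
      else if snd q = snd q' then (1 - \<rho>) * (1 - \<omega>)
      else 0)"

text \<open>Because the derivative is taken within \<open>S\<close>, it is one-sided at boundary points of \<open>S\<close>;
  \<open>f1\<close> and \<open>f2\<close> are the partial derivatives in the first and second argument.\<close>

definition C1_partials_on ::
  "(real \<times> real) set \<Rightarrow> (real \<Rightarrow> real \<Rightarrow> real) \<Rightarrow> (real \<Rightarrow> real \<Rightarrow> real) \<Rightarrow> (real \<Rightarrow> real \<Rightarrow> real) \<Rightarrow> bool"
where
  "C1_partials_on S f f1 f2 \<longleftrightarrow>
     (\<forall>(x, y) \<in> S. ((\<lambda>(x, y). f x y) has_derivative (\<lambda>(h, k). f1 x y * h + f2 x y * k))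
        (at (x, y) within S)) \<and>
     continuous_on S (\<lambda>(x, y). f1 x y) \<and> continuous_on S (\<lambda>(x, y). f2 x y)"

definition smooth_on_nonneg :: "(real \<Rightarrow> real) \<Rightarrow> bool" where
  "smooth_on_nonneg f \<longleftrightarrow>
     (\<exists>D :: nat \<Rightarrow> real \<Rightarrow> real. D 0 = f \<and>
        (\<forall>k. \<forall>x\<ge>0. (D k has_real_derivative D (Suc k) x) (at x within {0..})))"

definition strictly_convex_on :: "real set \<Rightarrow> (real \<Rightarrow> real) \<Rightarrow> bool" where
  "strictly_convex_on S f \<longleftrightarrow>
     (\<forall>x\<in>S. \<forall>y\<in>S. \<forall>t\<in>{0<..<1}. x \<noteq> y \<longrightarrow>
        f ((1 - t) * x + t * y) < (1 - t) * f x + t * f y)"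

definition strictly_concave_on :: "real set \<Rightarrow> (real \<Rightarrow> real) \<Rightarrow> bool" where
  "strictly_concave_on S f \<longleftrightarrow> strictly_convex_on S (\<lambda>x. - f x)"

text \<open>The supremum is a maximum whenever \<open>\<lambda>x. u x y\<close> has a maximizer on \<open>{0..}\<close>.\<close>

definition indirect_utility :: "(real \<Rightarrow> real \<Rightarrow> real) \<Rightarrow> real \<Rightarrow> real" where
  "indirect_utility u y = (SUP x\<in>{0..}. u x y)"

text \<open>Here \<open>e i\<close> is the earning potential and \<open>x i\<close> the consumption of agent \<open>i\<close>.\<close>

definition payoff ::
  "real^'n^'n \<Rightarrow> (real \<Rightarrow> real) \<Rightarrow> (real \<Rightarrow> real \<Rightarrow> real) \<Rightarrow> ('n \<Rightarrow> real) \<Rightarrow> ('n \<Rightarrow> real) \<Rightarrow> 'n::finite \<Rightarrow> real"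
where
  "payoff G F u e x i = u (x i) (e i) - (\<Sum>j | x i \<le> x j. G $ i $ j * F (x j - x i))"

definition nash_equilibrium ::
  "real^'n^'n \<Rightarrow> (real \<Rightarrow> real) \<Rightarrow> (real \<Rightarrow> real \<Rightarrow> real) \<Rightarrow> ('n \<Rightarrow> real) \<Rightarrow> ('n::finite \<Rightarrow> real) \<Rightarrow> bool"
where
  "nash_equilibrium G F u e x \<longleftrightarrow>
     (\<forall>i. 0 \<le> x i) \<and>
     (\<forall>i. \<forall>z\<ge>0. payoff G F u e (x(i := z)) i \<le> payoff G F u e x i)"

text \<open>Under the assumptions of the model the game has exactly one Nash equilibrium, so the
  description below denotes it.\<close>

definition equilibrium ::
  "real^'n^'n \<Rightarrow> (real \<Rightarrow> real) \<Rightarrow> (real \<Rightarrow> real \<Rightarrow> real) \<Rightarrow> ('n \<Rightarrow> real) \<Rightarrow> ('n::finite \<Rightarrow> real)"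
where
  "equilibrium G F u e = (THE x. nash_equilibrium G F u e x)"

definition equilibrium_welfare ::
  "(real^'n \<Rightarrow> real) \<Rightarrow> real^'n^'n \<Rightarrow> (real \<Rightarrow> real) \<Rightarrow> (real \<Rightarrow> real \<Rightarrow> real) \<Rightarrow> ('n::finite \<Rightarrow> real) \<Rightarrow> real"
where
  "equilibrium_welfare W G F u e = W (\<chi> i. payoff G F u e (equilibrium G F u e) i)"

definition pigou_dalton :: "(real^'n \<Rightarrow> real) \<Rightarrow> bool" where
  "pigou_dalton W \<longleftrightarrow>
     (\<forall>U i j \<epsilon>. U $ i > U $ j \<and> \<epsilon> > 0 \<and> U $ i - \<epsilon> \<ge> U $ j + \<epsilon> \<longrightarrow>
        W U \<le> W (\<chi> k. if k = i then U $ i - \<epsilon> else if k = j then U $ j + \<epsilon> else U $ k))"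

end

theory Submission
  imports Defs
begin

text \<open>
  Put \<open>t = y\<^sub>H\<^sub>P - y\<^sub>L\<^sub>P\<close>, so that the classes \<open>HR\<close>, \<open>LR\<close>, \<open>HP\<close>, \<open>LP\<close> have potentials \<open>h\<close>, \<open>h - t\<close>,
  \<open>l + t\<close>, \<open>l\<close> and mobility near 0 means \<open>t\<close> near 0. The unique equilibrium is found class by class from
  the top. When \<open>t\<close> rises, \<open>HR\<close> is unaffected, \<open>LR\<close> loses at rate about \<open>V'(h)\<close>, and \<open>HP\<close> gains at rate at
  least about \<open>V'(l) > V'(h)\<close>, because \<open>u\<^sub>y\<close> increases in consumption and \<open>V\<close> is strictly concave. \<open>LP\<close>
  gains from the fall of \<open>LR\<close>, while the rise of \<open>HP\<close> hurts it only to second order, since \<open>F'(0) = 0\<close> and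
  \<open>HP\<close> and \<open>LP\<close> consume the same at \<open>t = 0\<close>. As \<open>HP\<close> is worse off than \<open>LR\<close>, Pigou-Dalton gives it at least
  the same welfare weight, so welfare rises. Envelope estimates are made by finite differences, which
  avoids the differentiability of the equilibrium. Mobility near 1 is the same situation with
  \<open>HP\<close> and \<open>LR\<close>, and \<open>\<rho>\<close> and \<open>1 - \<rho>\<close>, exchanged.
\<close>

section \<open>Partial derivatives and the comparison penalty\<close>

lemma C1_partials_on_fst:
  assumes "C1_partials_on (A \<times> B) f f1 f2" "x \<in> A" "y \<in> B"
  shows "((\<lambda>x. f x y) has_real_derivative f1 x y) (at x within A)"
proof -
  have "((\<lambda>(x, y). f x y) has_derivative (\<lambda>(h, k). f1 x y * h + f2 x y * k)) (at (x, y) within A \<times> B)"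
    using assms unfolding C1_partials_on_def by blast
  then have "((\<lambda>(x, y). f x y) has_derivative (\<lambda>(h, k). f1 x y * h + f2 x y * k))
      (at (x, y) within (\<lambda>x. (x, y)) ` A)"
    by (rule has_derivative_subset) (use assms in auto)
  moreover have "((\<lambda>x. (x, y)) has_derivative (\<lambda>h. (h, 0))) (at x within A)"
    by (auto intro!: derivative_eq_intros)
  ultimately show ?thesis
    using has_derivative_in_compose[where f = "(\<lambda>x. (x, y))" and g = "\<lambda>(x, y). f x y"]
    by (fastforce simp: has_field_derivative_def)
qed

lemma C1_partials_on_snd:
  assumes "C1_partials_on (A \<times> B) f f1 f2" "x \<in> A" "y \<in> B"
  shows "((\<lambda>y. f x y) has_real_derivative f2 x y) (at y within B)"
proof -
  have "((\<lambda>(x, y). f x y) has_derivative (\<lambda>(h, k). f1 x y * h + f2 x y * k)) (at (x, y) within A \<times> B)"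
    using assms unfolding C1_partials_on_def by blast
  then have "((\<lambda>(x, y). f x y) has_derivative (\<lambda>(h, k). f1 x y * h + f2 x y * k))
      (at (x, y) within (\<lambda>y. (x, y)) ` B)"
    by (rule has_derivative_subset) (use assms in auto)
  moreover have "((\<lambda>y. (x, y)) has_derivative (\<lambda>h. (0, h))) (at y within B)"
    by (auto intro!: derivative_eq_intros)
  ultimately show ?thesis
    using has_derivative_in_compose[where f = "(\<lambda>y. (x, y))" and g = "\<lambda>(x, y). f x y"]
    by (fastforce simp: has_field_derivative_def)
qed

lemma C1_partials_on_continuous:
  assumes "C1_partials_on S f f1 f2"
  shows "continuous_on S (\<lambda>z. f1 (fst z) (snd z))" "continuous_on S (\<lambda>z. f2 (fst z) (snd z))"
  using assms by (simp_all add: C1_partials_on_def case_prod_beta)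

text \<open>Derivatives within \<open>S\<close> suffice, so the mean value theorem also applies to
  consumption intervals that start at the boundary point 0.\<close>

lemma real_mvt_within:
  fixes f :: "real \<Rightarrow> real"
  assumes "a \<le> b" "{a..b} \<subseteq> S"
    and "\<And>x. x \<in> {a..b} \<Longrightarrow> (f has_real_derivative f' x) (at x within S)"
  obtains x where "x \<in> {a..b}" "f b - f a = f' x * (b - a)"
proof -
  have "\<exists>x\<in>{a..b}. f b - f a = f' x * (b - a)"
    using assms by (intro mvt_very_simple[where f' = "\<lambda>x h. f' x * h"])
      (auto simp: has_field_derivative_def intro: has_derivative_subset)
  then show ?thesis using that by blast
qed

lemma strictly_convex_on_imp_convex_on:
  fixes f :: "real \<Rightarrow> real"
  assumes "strictly_convex_on S f" "convex S"
  shows "convex_on S f"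
proof (rule convex_onI)
  fix t x y :: real assume *: "t > 0" "t < 1" "x \<in> S" "y \<in> S"
  show "f ((1 - t) *\<^sub>R x + t *\<^sub>R y) \<le> (1 - t) * f x + t * f y"
  proof (cases "x = y")
    case True
    then show ?thesis by (simp add: algebra_simps)
  next
    case False
    then have "f ((1 - t) * x + t * y) < (1 - t) * f x + t * f y"
      using assms(1) * unfolding strictly_convex_on_def by (metis greaterThanLessThan_iff)
    then show ?thesis by simp
  qed
qed (rule assms)

text \<open>Extending F by zero to negative arguments is differentiable because F and its derivative
  vanish at 0. Convexity becomes monotonicity of \<open>p\<close>, and smoothness becomes a
  Lipschitz bound on every range bounded above; later arguments use the penalty only through these
  facts.\<close>

lemma penalty_derivative_exists:
  assumes F: "smooth_on_nonneg F" "strict_mono_on {0..} F" "strictly_convex_on {0..} F"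
      "F 0 = 0" "(F has_real_derivative 0) (at 0 within {0..})"
  obtains p where "\<And>r. ((\<lambda>r. F (max 0 r)) has_real_derivative p r) (at r)" "mono p"
    "\<And>r. r \<le> 0 \<Longrightarrow> p r = 0"
    "\<And>B. \<exists>L\<ge>0. \<forall>r s. r \<le> s \<longrightarrow> s \<le> B \<longrightarrow> p s - p r \<le> L * (s - r)"
proof -
  obtain D where D0: "D 0 = F"
    and D: "\<And>k x. x \<ge> 0 \<Longrightarrow> (D k has_real_derivative D (Suc k) x) (at x within {0..})"
    using F(1) unfolding smooth_on_nonneg_def by blast
  define q where "q = D 1"
  have q: "(F has_real_derivative q x) (at x within {0..})" if "x \<ge> 0" for x
    using D[of x 0] that by (simp add: q_def D0)
  have "q 0 = 0"
    using q[of 0] F(5) by (auto intro!: has_field_derivative_unique simp: at_within_Ici_at_right)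
  \<comment> \<open>Tangent lines are used only at interior points; the endpoint 0 is covered by
    \<open>q 0 = 0\<close>.\<close>
  have tangent: "F z - F x \<ge> q x * (z - x)" if "x > 0" "z \<ge> 0" for x z
    by (rule convex_on_imp_above_tangent[where A = "{0..}"])
      (use that q in \<open>auto intro!: strictly_convex_on_imp_convex_on F(3)\<close>)
  have q_nonneg: "0 \<le> q x" if "x > 0" for x
  proof -
    have "F 0 - F x \<ge> q x * (0 - x)"
      using tangent[of x 0] that by blast
    moreover have "F 0 < F x" using F(2) that by (auto simp: strict_mono_on_def)
    ultimately have "0 < q x * x" by simp
    then show ?thesis using that by (simp add: zero_less_mult_iff)
  qed
  have q_mono: "q x \<le> q y" if "0 \<le> x" "x \<le> y" for x y
  proof (cases "x = 0 \<or> x = y")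
    case False
    have "F y - F x \<ge> q x * (y - x)" "F x - F y \<ge> q y * (x - y)"
      using tangent False that by auto
    then have "(q y - q x) * (y - x) \<ge> 0" by (simp add: algebra_simps)
    then show ?thesis using False that by (simp add: zero_le_mult_iff)
  qed (use \<open>q 0 = 0\<close> q_nonneg[of y] that in \<open>cases "y = 0"; force\<close>)
  define p where "p r = q (max 0 r)" for r
  show ?thesis
  proof
    show "mono p" by (auto simp: mono_def p_def intro!: q_mono)
    show "p r = 0" if "r \<le> 0" for r using that \<open>q 0 = 0\<close> by (simp add: p_def max_def)
    show "((\<lambda>r. F (max 0 r)) has_real_derivative p r) (at r)" for r
    proof -
      consider "r < 0" | "r = 0" | "r > 0" by linarith
      then show ?thesis
      proof cases
        case 1
        have "((\<lambda>r. 0) has_real_derivative p r) (at r)"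
          using 1 \<open>q 0 = 0\<close> by (simp add: p_def max_def)
        then show ?thesis
          by (rule has_field_derivative_transform_within_open[where S = "{..<0}"])
            (use 1 F(4) in \<open>auto simp: max_def\<close>)
      next
        case 3
        have "(F has_real_derivative p r) (at r)"
        proof -
          have "(F has_real_derivative p r) (at r within {0<..})"
            using 3 by (auto simp: p_def max_def intro: DERIV_subset[OF q])
          then show ?thesis using 3 at_within_open[of r "{0<..}"] by simp
        qed
        then show ?thesis
          by (rule has_field_derivative_transform_within_open[where S = "{0<..}"])
            (use 3 in \<open>auto simp: max_def\<close>)
      next
        case 2
        have "((\<lambda>r. F (max 0 r)) has_real_derivative 0) (at 0 within {0..})"
          by (rule has_field_derivative_transform_within[OF F(5), of 1]) (auto simp: max_def)
        moreover have "((\<lambda>r. F (max 0 r)) has_real_derivative 0) (at 0 within {..0})"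
          by (rule has_field_derivative_transform_within[of "\<lambda>_. 0" _ _ _ 1]) (auto simp: max_def F(4))
        ultimately have "((\<lambda>r. F (max 0 r)) has_real_derivative 0) (at 0 within ({0..} \<union> {..0}))"
          unfolding has_field_derivative_iff by (rule Lim_within_Un[THEN iffD2, OF conjI])
        moreover have "{0..} \<union> {..0} = (UNIV :: real set)" by auto
        ultimately show ?thesis using 2 \<open>q 0 = 0\<close> by (simp add: p_def)
      qed
    qed
    show "\<exists>L\<ge>0. \<forall>r s. r \<le> s \<longrightarrow> s \<le> B \<longrightarrow> p s - p r \<le> L * (s - r)" for B
    proof -
      \<comment> \<open>The Lipschitz constant is a bound for the second derivative of F on a
        compact interval. Clipping at 0 does not increase distances, so the same constant serves for
        \<open>p\<close>.\<close>
      have "continuous_on {0..max 0 B} (D 2)"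
      proof (rule DERIV_continuous_on)
        show "(D 2 has_real_derivative D (Suc 2) x) (at x within {0..max 0 B})"
          if "x \<in> {0..max 0 B}" for x
          by (rule DERIV_subset[OF D]) (use that in auto)
      qed
      then have "bounded (D 2 ` {0..max 0 B})"
        by (intro compact_imp_bounded compact_continuous_image) auto
      then obtain L where L: "L > 0" "\<And>x. x \<in> {0..max 0 B} \<Longrightarrow> \<bar>D 2 x\<bar> \<le> L"
        unfolding bounded_pos by auto
      have "p s - p r \<le> L * (s - r)" if "r \<le> s" "s \<le> B" for r s
      proof -
        obtain x where x: "x \<in> {max 0 r..max 0 s}"
          "q (max 0 s) - q (max 0 r) = D 2 x * (max 0 s - max 0 r)"
        proof (rule real_mvt_within[of "max 0 r" "max 0 s" "{0..}" q "D 2"])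
          show "(q has_real_derivative D 2 x) (at x within {0..})"
            if "x \<in> {max 0 r..max 0 s}" for x
            using D[of x 1] that by (simp add: q_def eval_nat_numeral)
        qed (use \<open>r \<le> s\<close> in auto)
        have "x \<in> {0..max 0 B}"
          using x(1) \<open>s \<le> B\<close> by (auto simp: le_max_iff_disj)
        then have "D 2 x \<le> L"
          using L(2) abs_le_D1 by blast
        then have "q (max 0 s) - q (max 0 r) \<le> L * (max 0 s - max 0 r)"
          using x(2) \<open>r \<le> s\<close> by (simp add: mult_right_mono)
        also have "\<dots> \<le> L * (s - r)"
          using L(1) \<open>r \<le> s\<close> by (intro mult_left_mono) auto
        finally show ?thesis by (simp add: p_def)
      qed
      then show ?thesis using L(1) by (intro exI[of _ L]) auto
    qed
  qed
qed

section \<open>Best responses and Nash equilibrium\<close>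

text \<open>Here \<open>p\<close> is the marginal penalty, extended by zero to those who are not
  ahead. Since \<open>p\<close> is monotone, the one-sided bound in \<open>p_lipschitz\<close> is a
  genuine Lipschitz condition.\<close>

locale status_game =
  fixes Y :: "real set" and u ux uy uxx uxy :: "real \<Rightarrow> real \<Rightarrow> real" and F p :: "real \<Rightarrow> real"
  assumes open_Y: "open Y" and interval_Y: "is_interval Y"
    and C1_u: "C1_partials_on ({0..} \<times> Y) u ux uy"
    and C1_ux: "C1_partials_on ({0..} \<times> Y) ux uxx uxy"
    and uxx_neg: "\<And>x \<eta>. x \<ge> 0 \<Longrightarrow> \<eta> \<in> Y \<Longrightarrow> uxx x \<eta> < 0"
    and argmax_interior: "\<And>\<eta>. \<eta> \<in> Y \<Longrightarrow> \<exists>x>0. is_arg_max (\<lambda>x. u x \<eta>) (\<lambda>x. x \<ge> 0) x"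
    and uy_pos: "\<And>x \<eta>. x \<ge> 0 \<Longrightarrow> \<eta> \<in> Y \<Longrightarrow> uy x \<eta> > 0"
    and uxy_pos: "\<And>x \<eta>. x > 0 \<Longrightarrow> \<eta> \<in> Y \<Longrightarrow> uxy x \<eta> > 0"
    and V_concave: "strictly_concave_on Y (indirect_utility u)"
    and F_0: "F 0 = 0"
    and F_deriv: "\<And>r. ((\<lambda>r. F (max 0 r)) has_real_derivative p r) (at r)"
    and mono_p: "mono p"
    and p_nonpos: "\<And>r. r \<le> 0 \<Longrightarrow> p r = 0"
    and p_lipschitz: "\<And>B. \<exists>L\<ge>0. \<forall>r s. r \<le> s \<longrightarrow> s \<le> B \<longrightarrow> p s - p r \<le> L * (s - r)"
begin

abbreviation envy :: "real \<Rightarrow> real" where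
  "envy r \<equiv> F (max 0 r)"

lemma envy_mvt:
  assumes "r \<le> s"
  obtains z where "r \<le> z" "z \<le> s" "envy s - envy r = p z * (s - r)"
  using real_mvt_within[of r s UNIV envy p] assms F_deriv by auto

lemma p_nonneg: "0 \<le> p r"
  using monoD[OF mono_p, of "min r 0" r] p_nonpos[of "min r 0"] by simp

lemma envy_mono: "r \<le> s \<Longrightarrow> envy r \<le> envy s"
  by (metis envy_mvt p_nonneg diff_ge_0_iff_ge mult_nonneg_nonneg)

lemma Icc_subset_Y: "l \<in> Y \<Longrightarrow> h \<in> Y \<Longrightarrow> {l..h} \<subseteq> Y"
  using interval_Y by (simp add: interval_subset_is_interval flip: box_real)

section \<open>Partial derivatives of u and monotonicity of marginal utility\<close>

lemma u_deriv_x: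
  "x \<ge> 0 \<Longrightarrow> \<eta> \<in> Y \<Longrightarrow> ((\<lambda>x. u x \<eta>) has_real_derivative ux x \<eta>) (at x within {0..})"
  using C1_partials_on_fst[OF C1_u] by simp

lemma ux_deriv_x:
  "x \<ge> 0 \<Longrightarrow> \<eta> \<in> Y \<Longrightarrow> ((\<lambda>x. ux x \<eta>) has_real_derivative uxx x \<eta>) (at x within {0..})"
  using C1_partials_on_fst[OF C1_ux] by simp

lemma u_deriv_y:
  "x \<ge> 0 \<Longrightarrow> \<eta> \<in> Y \<Longrightarrow> ((\<lambda>\<eta>. u x \<eta>) has_real_derivative uy x \<eta>) (at \<eta> within Y)"
  using C1_partials_on_snd[OF C1_u] by simp

lemma ux_deriv_y:
  "x \<ge> 0 \<Longrightarrow> \<eta> \<in> Y \<Longrightarrow> ((\<lambda>\<eta>. ux x \<eta>) has_real_derivative uxy x \<eta>) (at \<eta> within Y)"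
  using C1_partials_on_snd[OF C1_ux] by simp

lemma u_mvt_y:
  assumes "x \<ge> 0" "\<eta>\<^sub>1 \<in> Y" "\<eta>\<^sub>2 \<in> Y" "\<eta>\<^sub>1 \<le> \<eta>\<^sub>2"
  obtains \<eta> where "\<eta> \<in> {\<eta>\<^sub>1..\<eta>\<^sub>2}" "\<eta> \<in> Y" "u x \<eta>\<^sub>2 - u x \<eta>\<^sub>1 = uy x \<eta> * (\<eta>\<^sub>2 - \<eta>\<^sub>1)"
proof -
  have sub: "{\<eta>\<^sub>1..\<eta>\<^sub>2} \<subseteq> Y" by (rule Icc_subset_Y[OF assms(2,3)])
  obtain \<eta> where "\<eta> \<in> {\<eta>\<^sub>1..\<eta>\<^sub>2}" "u x \<eta>\<^sub>2 - u x \<eta>\<^sub>1 = uy x \<eta> * (\<eta>\<^sub>2 - \<eta>\<^sub>1)"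
    by (rule real_mvt_within[OF assms(4) sub, of "u x" "uy x"]) (use u_deriv_y assms(1) sub in auto)
  then show ?thesis using that sub by blast
qed

lemma ux_mvt_x:
  assumes "0 \<le> x\<^sub>1" "x\<^sub>1 \<le> x\<^sub>2" "\<eta> \<in> Y"
  obtains x where "x \<in> {x\<^sub>1..x\<^sub>2}" "ux x\<^sub>2 \<eta> - ux x\<^sub>1 \<eta> = uxx x \<eta> * (x\<^sub>2 - x\<^sub>1)"
  by (rule real_mvt_within[of x\<^sub>1 x\<^sub>2 "{0..}" "\<lambda>x. ux x \<eta>" "\<lambda>x. uxx x \<eta>"])
    (use ux_deriv_x assms in auto)

lemma ux_mvt_y:
  assumes "x \<ge> 0" "\<eta>\<^sub>1 \<in> Y" "\<eta>\<^sub>2 \<in> Y" "\<eta>\<^sub>1 \<le> \<eta>\<^sub>2"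
  obtains \<eta> where "\<eta> \<in> {\<eta>\<^sub>1..\<eta>\<^sub>2}" "\<eta> \<in> Y" "ux x \<eta>\<^sub>2 - ux x \<eta>\<^sub>1 = uxy x \<eta> * (\<eta>\<^sub>2 - \<eta>\<^sub>1)"
proof -
  have sub: "{\<eta>\<^sub>1..\<eta>\<^sub>2} \<subseteq> Y" by (rule Icc_subset_Y[OF assms(2,3)])
  obtain \<eta> where "\<eta> \<in> {\<eta>\<^sub>1..\<eta>\<^sub>2}" "ux x \<eta>\<^sub>2 - ux x \<eta>\<^sub>1 = uxy x \<eta> * (\<eta>\<^sub>2 - \<eta>\<^sub>1)"
    by (rule real_mvt_within[OF assms(4) sub, of "ux x" "uxy x"]) (use ux_deriv_y assms(1) sub in auto)
  then show ?thesis using that sub by blast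
qed

lemma ux_strict_antimono:
  assumes "0 \<le> x\<^sub>1" "x\<^sub>1 < x\<^sub>2" "\<eta> \<in> Y"
  shows "ux x\<^sub>2 \<eta> < ux x\<^sub>1 \<eta>"
proof -
  obtain x where "x \<in> {x\<^sub>1..x\<^sub>2}" "ux x\<^sub>2 \<eta> - ux x\<^sub>1 \<eta> = uxx x \<eta> * (x\<^sub>2 - x\<^sub>1)"
    using assms ux_mvt_x[of x\<^sub>1 x\<^sub>2 \<eta>] by auto
  moreover have "uxx x \<eta> * (x\<^sub>2 - x\<^sub>1) < 0"
    using calculation(1) assms uxx_neg[of x \<eta>] by (intro mult_neg_pos) auto
  ultimately show ?thesis by simp
qed

lemma ux_mono_y:
  assumes "0 < x" "\<eta>\<^sub>1 \<in> Y" "\<eta>\<^sub>2 \<in> Y" "\<eta>\<^sub>1 \<le> \<eta>\<^sub>2"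
  shows "ux x \<eta>\<^sub>1 \<le> ux x \<eta>\<^sub>2"
proof -
  obtain \<eta> where "\<eta> \<in> Y" "ux x \<eta>\<^sub>2 - ux x \<eta>\<^sub>1 = uxy x \<eta> * (\<eta>\<^sub>2 - \<eta>\<^sub>1)"
    using assms ux_mvt_y[of x \<eta>\<^sub>1 \<eta>\<^sub>2] by auto
  moreover have "uxy x \<eta> * (\<eta>\<^sub>2 - \<eta>\<^sub>1) \<ge> 0"
    using calculation(1) assms uxy_pos[of x \<eta>] by (intro mult_nonneg_nonneg) auto
  ultimately show ?thesis by simp
qed

lemma u_strict_mono_y:
  assumes "0 \<le> x" "\<eta>\<^sub>1 \<in> Y" "\<eta>\<^sub>2 \<in> Y" "\<eta>\<^sub>1 < \<eta>\<^sub>2"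
  shows "u x \<eta>\<^sub>1 < u x \<eta>\<^sub>2"
proof -
  obtain \<eta> where "\<eta> \<in> Y" "u x \<eta>\<^sub>2 - u x \<eta>\<^sub>1 = uy x \<eta> * (\<eta>\<^sub>2 - \<eta>\<^sub>1)"
    using assms u_mvt_y[of x \<eta>\<^sub>1 \<eta>\<^sub>2] by auto
  moreover have "uy x \<eta> * (\<eta>\<^sub>2 - \<eta>\<^sub>1) > 0"
    using calculation(1) assms uy_pos[of x \<eta>] by (intro mult_pos_pos) auto
  ultimately show ?thesis by simp
qed

text \<open>Increasing differences: as a function of consumption, the gain from a higher potential
  has slope \<open>ux x \<eta>\<^sub>2 - ux x \<eta>\<^sub>1\<close>, which is nonnegative by
  \<open>ux_mono_y\<close>.\<close>

lemma u_supermodular: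
  assumes "0 < x\<^sub>1" "x\<^sub>1 \<le> x\<^sub>2" "\<eta>\<^sub>1 \<in> Y" "\<eta>\<^sub>2 \<in> Y" "\<eta>\<^sub>1 \<le> \<eta>\<^sub>2"
  shows "u x\<^sub>1 \<eta>\<^sub>2 - u x\<^sub>1 \<eta>\<^sub>1 \<le> u x\<^sub>2 \<eta>\<^sub>2 - u x\<^sub>2 \<eta>\<^sub>1"
proof -
  obtain x where x: "x \<in> {x\<^sub>1..x\<^sub>2}"
    "(u x\<^sub>2 \<eta>\<^sub>2 - u x\<^sub>2 \<eta>\<^sub>1) - (u x\<^sub>1 \<eta>\<^sub>2 - u x\<^sub>1 \<eta>\<^sub>1) = (ux x \<eta>\<^sub>2 - ux x \<eta>\<^sub>1) * (x\<^sub>2 - x\<^sub>1)"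
    by (rule real_mvt_within[of x\<^sub>1 x\<^sub>2 "{0..}" "\<lambda>x. u x \<eta>\<^sub>2 - u x \<eta>\<^sub>1" "\<lambda>x. ux x \<eta>\<^sub>2 - ux x \<eta>\<^sub>1"])
      (use assms in \<open>auto intro!: DERIV_diff u_deriv_x\<close>)
  have "(ux x \<eta>\<^sub>2 - ux x \<eta>\<^sub>1) * (x\<^sub>2 - x\<^sub>1) \<ge> 0"
    using x(1) assms ux_mono_y[of x \<eta>\<^sub>1 \<eta>\<^sub>2] by (intro mult_nonneg_nonneg) auto
  then show ?thesis using x(2) by linarith
qed

section \<open>First-order conditions of a single agent\<close>

lemma max_imp_foc:
  assumes \<eta>: "\<eta> \<in> Y" and K: "\<And>z. (K has_real_derivative - k z) (at z)" and k: "\<And>z. 0 \<le> k z"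
    and x: "0 \<le> x" and max: "\<And>z. 0 \<le> z \<Longrightarrow> u z \<eta> - K z \<le> u x \<eta> - K x"
    and ux_0: "0 < ux 0 \<eta>"
  shows "0 < x \<and> ux x \<eta> + k x = 0"
proof -
  \<comment> \<open>\<open>K\<close> is the envy cost as a function of own consumption, and
    \<open>k\<close> is the marginal relief from envy that extra consumption brings.\<close>
  have der: "((\<lambda>z. u z \<eta> - K z) has_real_derivative (ux z \<eta> + k z)) (at z within {0..})" if "0 \<le> z" for z
    using DERIV_diff[OF u_deriv_x[OF that \<eta>] DERIV_subset[OF K]] by simp
  \<comment> \<open>At 0 both marginal utility and relief push upwards, so a small increase would be
    profitable. The maximizer is therefore interior and stationary.\<close>
  have "x \<noteq> 0"
  proof
    assume "x = 0"
    have "0 < ux 0 \<eta> + k 0" using ux_0 k[of 0] by linarith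
    from has_real_derivative_pos_inc_right[OF der[of 0] this]
    obtain \<delta> where "\<delta> > 0" "\<forall>h>0. 0 + h \<in> {0..} \<longrightarrow> h < \<delta> \<longrightarrow> u 0 \<eta> - K 0 < u (0 + h) \<eta> - K (0 + h)"
      by auto
    then have "u 0 \<eta> - K 0 < u (\<delta> / 2) \<eta> - K (\<delta> / 2)" by auto
    then show False using max[of "\<delta> / 2"] \<open>\<delta> > 0\<close> \<open>x = 0\<close> by simp
  qed
  then have "x > 0" using x by simp
  have "((\<lambda>z. u z \<eta> - K z) has_real_derivative (ux x \<eta> + k x)) (at x within {0<..})"
    by (rule DERIV_subset[OF der]) (use x in auto)
  then have "((\<lambda>z. u z \<eta> - K z) has_real_derivative (ux x \<eta> + k x)) (at x)"
    using \<open>x > 0\<close> at_within_open[of x "{0<..}"] by simp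
  then have "ux x \<eta> + k x = 0"
    by (rule DERIV_local_max[OF _ \<open>x > 0\<close>]) (use max in auto)
  then show ?thesis using \<open>x > 0\<close> by simp
qed

text \<open>The slope \<open>ux z \<eta> + k z\<close> decreases in z, so the objective rises up to
  the stationary point and falls afterwards.\<close>

lemma foc_imp_max:
  assumes \<eta>: "\<eta> \<in> Y" and K: "\<And>z. (K has_real_derivative - k z) (at z)" and k: "antimono k"
    and x: "0 \<le> x" and foc: "ux x \<eta> + k x = 0" and z: "0 \<le> z"
  shows "u z \<eta> - K z \<le> u x \<eta> - K x"
proof -
  have der: "((\<lambda>z. u z \<eta> - K z) has_real_derivative (ux z \<eta> + k z)) (at z within {0..})" if "0 \<le> z" for z
    using DERIV_diff[OF u_deriv_x[OF that \<eta>] DERIV_subset[OF K]] by simp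
  have anti: "ux v \<eta> + k v \<le> ux w \<eta> + k w" if "0 \<le> w" "w \<le> v" for v w
    using ux_strict_antimono[of w v \<eta>] antimonoD[OF k, of w v] that \<eta> by (cases "w = v") auto
  show ?thesis
  proof (cases "z \<le> x")
    case True
    obtain w where "w \<in> {z..x}"
      "(u x \<eta> - K x) - (u z \<eta> - K z) = (ux w \<eta> + k w) * (x - z)"
      using real_mvt_within[OF True, of "{0..}" "\<lambda>z. u z \<eta> - K z" "\<lambda>z. ux z \<eta> + k z"] der z
      by auto
    moreover have "(ux w \<eta> + k w) * (x - z) \<ge> 0"
      using calculation(1) anti[of w x] foc z by (intro mult_nonneg_nonneg) auto
    ultimately show ?thesis by simp
  next
    case False
    then have "x \<le> z" by simp
    then obtain w where "w \<in> {x..z}"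
      "(u z \<eta> - K z) - (u x \<eta> - K x) = (ux w \<eta> + k w) * (z - x)"
      using real_mvt_within[of x z "{0..}" "\<lambda>z. u z \<eta> - K z" "\<lambda>z. ux z \<eta> + k z"] der x
      by auto
    moreover have "(ux w \<eta> + k w) * (z - x) \<le> 0"
      using calculation(1) anti[of x w] foc x by (intro mult_nonpos_nonneg) auto
    ultimately show ?thesis by simp
  qed
qed

text \<open>Monotone comparative statics: at \<open>x\<^sub>1\<close> the second slope is at least
  the first, hence nonnegative, and being strictly decreasing it can vanish only at
  \<open>x\<^sub>1\<close> or to its right.\<close>

lemma foc_comparison:
  assumes "0 < x\<^sub>1" "0 < x\<^sub>2" "\<eta>\<^sub>1 \<in> Y" "\<eta>\<^sub>2 \<in> Y" "\<eta>\<^sub>1 \<le> \<eta>\<^sub>2"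
    and "ux x\<^sub>1 \<eta>\<^sub>1 + k\<^sub>1 x\<^sub>1 = 0" "ux x\<^sub>2 \<eta>\<^sub>2 + k\<^sub>2 x\<^sub>2 = 0"
    and "antimono k\<^sub>2" "k\<^sub>1 x\<^sub>1 \<le> k\<^sub>2 x\<^sub>1"
  shows "x\<^sub>1 \<le> x\<^sub>2"
proof (rule ccontr)
  assume "\<not> x\<^sub>1 \<le> x\<^sub>2"
  then have "ux x\<^sub>1 \<eta>\<^sub>2 < ux x\<^sub>2 \<eta>\<^sub>2" "k\<^sub>2 x\<^sub>1 \<le> k\<^sub>2 x\<^sub>2"
    using ux_strict_antimono[of x\<^sub>2 x\<^sub>1 \<eta>\<^sub>2] antimonoD[OF assms(8), of x\<^sub>2 x\<^sub>1] assms by auto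
  moreover have "ux x\<^sub>1 \<eta>\<^sub>1 \<le> ux x\<^sub>1 \<eta>\<^sub>2"
    using ux_mono_y assms by simp
  ultimately show False using assms by linarith
qed

section \<open>Bliss points and the indirect utility\<close>

definition aspiration :: "real \<Rightarrow> real" where
  "aspiration \<eta> = (SOME x. x > 0 \<and> is_arg_max (\<lambda>x. u x \<eta>) (\<lambda>x. x \<ge> 0) x)"

lemma aspiration:
  assumes "\<eta> \<in> Y"
  shows aspiration_pos: "aspiration \<eta> > 0"
    and aspiration_max: "\<And>x. x \<ge> 0 \<Longrightarrow> u x \<eta> \<le> u (aspiration \<eta>) \<eta>"
proof -
  have *: "aspiration \<eta> > 0 \<and> is_arg_max (\<lambda>x. u x \<eta>) (\<lambda>x. x \<ge> 0) (aspiration \<eta>)"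
    unfolding aspiration_def by (rule someI_ex) (use argmax_interior[OF assms] in blast)
  show "aspiration \<eta> > 0" using * by blast
  show "u x \<eta> \<le> u (aspiration \<eta>) \<eta>" if "x \<ge> 0" for x
    using * that unfolding is_arg_max_def by (metis not_le)
qed

lemma ux_aspiration:
  assumes "\<eta> \<in> Y"
  shows "ux (aspiration \<eta>) \<eta> = 0"
proof -
  have "((\<lambda>x. u x \<eta>) has_real_derivative ux (aspiration \<eta>) \<eta>) (at (aspiration \<eta>) within {0<..})"
    by (rule DERIV_subset[OF u_deriv_x]) (use aspiration_pos[OF assms] assms in auto)
  then have "((\<lambda>x. u x \<eta>) has_real_derivative ux (aspiration \<eta>) \<eta>) (at (aspiration \<eta>))"
    using aspiration_pos[OF assms] at_within_open[of "aspiration \<eta>" "{0<..}"] by simp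
  then show ?thesis
    by (rule DERIV_local_max[OF _ aspiration_pos[OF assms]]) (use aspiration_max[OF assms] in auto)
qed

lemma ux_0_pos: "\<eta> \<in> Y \<Longrightarrow> 0 < ux 0 \<eta>"
  using ux_strict_antimono[of 0 "aspiration \<eta>" \<eta>] aspiration_pos ux_aspiration by simp

lemma indirect_utility_eq:
  assumes "\<eta> \<in> Y"
  shows "indirect_utility u \<eta> = u (aspiration \<eta>) \<eta>"
  unfolding indirect_utility_def
  by (rule cSup_eq_maximum) (use aspiration_pos[OF assms] aspiration_max[OF assms] in auto)

lemma indirect_utility_ge: "\<eta> \<in> Y \<Longrightarrow> x \<ge> 0 \<Longrightarrow> u x \<eta> \<le> indirect_utility u \<eta>"
  by (simp add: indirect_utility_eq aspiration_max)

lemma aspiration_mono: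
  assumes "\<eta>\<^sub>1 \<in> Y" "\<eta>\<^sub>2 \<in> Y" "\<eta>\<^sub>1 \<le> \<eta>\<^sub>2"
  shows "aspiration \<eta>\<^sub>1 \<le> aspiration \<eta>\<^sub>2"
  by (rule foc_comparison[where k\<^sub>1 = "\<lambda>_. 0" and k\<^sub>2 = "\<lambda>_. 0" and \<eta>\<^sub>1 = \<eta>\<^sub>1 and \<eta>\<^sub>2 = \<eta>\<^sub>2])
    (use assms aspiration_pos ux_aspiration in \<open>auto simp: monotone_on_def\<close>)

section \<open>Nash equilibria as solutions of first-order conditions\<close>

lemma envy_deriv: "((\<lambda>z. envy (c - z)) has_real_derivative - p (c - z)) (at z)"
proof -
  have "((\<lambda>z. envy (c - z)) has_real_derivative p (c - z) * (0 - 1)) (at z)"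
    by (rule DERIV_chain2[OF F_deriv]) (auto intro!: derivative_eq_intros)
  then show ?thesis by simp
qed

lemma antimono_p: "0 \<le> g \<Longrightarrow> antimono (\<lambda>z. g * p (c - z))"
  by (intro antimonoI mult_left_mono monoD[OF mono_p]) auto

lemma envy_sum_deriv:
  "((\<lambda>z. \<Sum>j\<in>A. g j * envy (x j - z)) has_real_derivative - (\<Sum>j\<in>A. g j * p (x j - z))) (at z)"
proof -
  have "((\<lambda>z. \<Sum>j\<in>A. g j * envy (x j - z)) has_real_derivative
      (\<Sum>j\<in>A. g j * - p (x j - z))) (at z)"
    by (intro DERIV_sum DERIV_cmult envy_deriv)
  then show ?thesis by (simp add: sum_negf)
qed

lemma antimono_envy_sum:
  "(\<And>j. j \<in> A \<Longrightarrow> 0 \<le> g j) \<Longrightarrow> antimono (\<lambda>z. \<Sum>j\<in>A. g j * p (x j - z))"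
  by (intro antimonoI sum_mono mult_left_mono monoD[OF mono_p]) auto

text \<open>After clipping, everyone who is not ahead contributes F 0 = 0, so the range of the sum
  no longer depends on own consumption. The own summand, the only one affected by the update, has
  weight zero.\<close>

lemma payoff_update:
  assumes "G $ i $ i = 0"
  shows "payoff G F u e (x(i := z)) i = u z (e i) - (\<Sum>j\<in>UNIV. G $ i $ j * envy (x j - z))"
proof -
  have "(\<Sum>j | (x(i := z)) i \<le> (x(i := z)) j. G $ i $ j * F ((x(i := z)) j - (x(i := z)) i))
      = (\<Sum>j\<in>UNIV. G $ i $ j * envy (x j - z))"
    by (rule sum.mono_neutral_cong_left) (auto simp: assms F_0)
  then show ?thesis by (simp add: payoff_def)
qed

text \<open>Given the others, each agent maximizes a concave function with positive slope at 0, so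
  best responses are exactly the positive stationary points. The game becomes a system of
  equations.\<close>

lemma nash_equilibrium_iff_foc:
  fixes G :: "real^'n^'n"
  assumes G: "\<And>i j. G $ i $ j \<ge> 0" "\<And>i. G $ i $ i = 0" and e: "\<And>i. e i \<in> Y"
  shows "nash_equilibrium G F u e x \<longleftrightarrow>
    (\<forall>i. 0 < x i \<and> ux (x i) (e i) + (\<Sum>j\<in>UNIV. G $ i $ j * p (x j - x i)) = 0)"
    (is "_ \<longleftrightarrow> (\<forall>i. ?foc i)")
proof -
  define K where "K i z = (\<Sum>j\<in>UNIV. G $ i $ j * envy (x j - z))" for i z
  define k where "k i z = (\<Sum>j\<in>UNIV. G $ i $ j * p (x j - z))" for i z
  have K: "(K i has_real_derivative - k i z) (at z)" for i z
    unfolding K_def k_def by (rule envy_sum_deriv)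
  have k: "antimono (k i)" "0 \<le> k i z" for i z
    unfolding k_def using G(1) p_nonneg by (auto intro!: antimono_envy_sum sum_nonneg)
  have pay: "payoff G F u e (x(i := z)) i = u z (e i) - K i z" for i z
    unfolding K_def by (rule payoff_update[OF G(2)])
  have pay0: "payoff G F u e x i = u (x i) (e i) - K i (x i)" for i
    using pay[of i "x i"] by simp
  have "0 \<le> x i \<and> (\<forall>z\<ge>0. payoff G F u e (x(i := z)) i \<le> payoff G F u e x i) \<longleftrightarrow> ?foc i" for i
    unfolding pay pay0 k_def[symmetric]
    using max_imp_foc[OF e K k(2) _ _ ux_0_pos[OF e]] foc_imp_max[OF e K k(1)]
    by (metis less_imp_le)
  then show ?thesis unfolding nash_equilibrium_def by blast
qed

lemma foc_unique:
  fixes G :: "real^'n^'n"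
  assumes G: "\<And>i j. G $ i $ j \<ge> 0" and e: "\<And>i. e i \<in> Y"
    and x: "\<And>i. 0 < x i \<and> ux (x i) (e i) + (\<Sum>j\<in>UNIV. G $ i $ j * p (x j - x i)) = 0"
    and x': "\<And>i. 0 < x' i \<and> ux (x' i) (e i) + (\<Sum>j\<in>UNIV. G $ i $ j * p (x' j - x' i)) = 0"
  shows "x i \<le> x' i"
proof (rule ccontr)
  assume "\<not> x i \<le> x' i"
  \<comment> \<open>where \<open>x - x'\<close> is maximal, envy is weaker under \<open>x\<close>, although consumption is larger\<close>
  obtain k where k: "\<And>j. x j - x' j \<le> x k - x' k"
  proof -
    have "Max (range (\<lambda>j. x j - x' j)) \<in> range (\<lambda>j. x j - x' j)" by (rule Max_in) auto
    then obtain k where "Max (range (\<lambda>j. x j - x' j)) = x k - x' k" by blast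
    then show ?thesis using that[of k] Max_ge[of "range (\<lambda>j. x j - x' j)"] by auto
  qed
  have "x' k < x k" using \<open>\<not> x i \<le> x' i\<close> k[of i] by linarith
  then have "ux (x k) (e k) < ux (x' k) (e k)"
    using ux_strict_antimono x' e by (meson less_imp_le)
  moreover have "(\<Sum>j\<in>UNIV. G $ k $ j * p (x j - x k)) \<le> (\<Sum>j\<in>UNIV. G $ k $ j * p (x' j - x' k))"
    by (intro sum_mono mult_left_mono monoD[OF mono_p] G) (use k in \<open>simp add: algebra_simps\<close>)
  ultimately show False using x[of k] x'[of k] by linarith
qed

text \<open>Applying \<open>foc_unique\<close> in both directions identifies any two solutions. It
  then remains only to exhibit one, which is done class by class below.\<close>

lemma equilibrium_eqI:
  fixes G :: "real^'n^'n"
  assumes G: "\<And>i j. G $ i $ j \<ge> 0" "\<And>i. G $ i $ i = 0" and e: "\<And>i. e i \<in> Y"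
    and x: "\<And>i. 0 < x i \<and> ux (x i) (e i) + (\<Sum>j\<in>UNIV. G $ i $ j * p (x j - x i)) = 0"
  shows "equilibrium G F u e = x"
  unfolding equilibrium_def nash_equilibrium_iff_foc[OF G e]
proof (rule the_equality)
  fix x' assume x': "\<forall>i. 0 < x' i \<and> ux (x' i) (e i) + (\<Sum>j\<in>UNIV. G $ i $ j * p (x' j - x' i)) = 0"
  show "x' = x"
  proof (intro ext antisym)
    show "x' i \<le> x i" "x i \<le> x' i" for i
      by (rule foc_unique[of G e]; use G(1) e x x' in blast)+
  qed
qed (use x in blast)

text \<open>Monotonicity turns the upper bound on increments into a two-sided Lipschitz bound.
  Continuity is what the intermediate value argument in \<open>foc_root\<close> requires.\<close>

lemma isCont_p: "isCont p r"
proof -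
  obtain L where L: "L \<ge> 0" "\<And>s t. s \<le> t \<Longrightarrow> t \<le> r + 1 \<Longrightarrow> p t - p s \<le> L * (t - s)"
    using p_lipschitz[of "r + 1"] by blast
  have "\<bar>p s - p t\<bar> \<le> L * \<bar>s - t\<bar>" if "s < r + 1" "t < r + 1" for s t
    using L(2)[of s t] L(2)[of t s] monoD[OF mono_p, of s t] monoD[OF mono_p, of t s] that
    by (cases "s \<le> t") auto
  then have "L-lipschitz_on {..<r + 1} p"
    using L(1) by (intro lipschitz_onI) (auto simp: dist_real_def)
  then have "continuous_on {..<r + 1} p" by (rule lipschitz_on_continuous_on)
  then show ?thesis by (simp add: continuous_on_eq_continuous_at)
qed

text \<open>Chord slopes of the strictly concave indirect utility decrease strictly; the
  denominators are cleared.\<close>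

lemma V_slopes:
  assumes "x \<in> Y" "y \<in> Y" "z \<in> Y" "x < y" "y < z"
  shows "(indirect_utility u z - indirect_utility u y) * (y - x)
    < (indirect_utility u y - indirect_utility u x) * (z - y)"
proof -
  let ?V = "indirect_utility u" and ?t = "(y - x) / (z - x)"
  have t: "?t \<in> {0<..<1}" using assms by (auto simp: field_simps)
  have "(1 - ?t) * x + ?t * z = x + ?t * (z - x)" by (simp only: algebra_simps)
  also have "\<dots> = y" using assms by simp
  finally have y: "(1 - ?t) * x + ?t * z = y" .
  have "- ?V ((1 - ?t) * x + ?t * z) < (1 - ?t) * - ?V x + ?t * - ?V z"
    using V_concave assms(1,3,4,5) t unfolding strictly_concave_on_def strictly_convex_on_def
    by (metis less_trans less_irrefl)
  then have "(1 - ?t) * ?V x + ?t * ?V z < ?V y"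
    unfolding y by simp
  then have lt: "((1 - ?t) * ?V x + ?t * ?V z) * (z - x) < ?V y * (z - x)"
    using assms by (intro mult_strict_right_mono) auto
  have eq: "((1 - ?t) * ?V x + ?t * ?V z) * (z - x)
      = (z - x) * ?V x - (?t * (z - x)) * ?V x + (?t * (z - x)) * ?V z"
    by (simp only: algebra_simps)
  have t_eq: "?t * (z - x) = y - x" using assms by simp
  have "(z - x) * ?V x - (y - x) * ?V x + (y - x) * ?V z < ?V y * (z - x)"
    using lt unfolding eq t_eq .
  moreover have "(?V y - ?V x) * (z - y) - (?V z - ?V y) * (y - x)
      = ?V y * (z - x) - ((z - x) * ?V x - (y - x) * ?V x + (y - x) * ?V z)"
    by algebra
  ultimately show ?thesis by linarith
qed

text \<open>Envelope argument: \<open>u\<^sub>y\<close> at the bliss points is the slope of the strictly concave \<open>V\<close>.\<close>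

lemma uy_aspiration_less:
  assumes "l \<in> Y" "h \<in> Y" "l < h"
  shows "uy (aspiration h) h < uy (aspiration l) l"
proof -
  let ?V = "indirect_utility u" and ?m = "(l + h) / 2"
  have m: "?m \<in> Y" "l < ?m" "?m < h"
    using Icc_subset_Y[OF assms(1,2)] assms(3) by auto
  \<comment> \<open>The chord slopes of V over the upper and lower half of [l, h] satisfy S1 < S2
    and separate the two marginal utilities.\<close>
  define S1 where "S1 = (?V h - ?V ?m) / (h - ?m)"
  define S2 where "S2 = (?V ?m - ?V l) / (?m - l)"
  have S1: "?V h - ?V ?m = S1 * (h - ?m)" and S2: "?V ?m - ?V l = S2 * (?m - l)"
    using m by (simp_all add: S1_def S2_def)
  have "S1 * ((h - ?m) * (?m - l)) < S2 * ((h - ?m) * (?m - l))"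
    using V_slopes[OF assms(1) m(1) assms(2) m(2,3)] unfolding S1 S2 by (simp only: mult_ac)
  then have "S1 < S2"
    using m by (simp add: mult_less_cancel_right)
  \<comment> \<open>With consumption fixed at its bliss point, u lies below V and touches it at h.
    If u grew faster than S1 just above h, so would V, against concavity; openness of Y leaves room
    beyond h.\<close>
  have "uy (aspiration h) h \<le> S1"
  proof (rule ccontr)
    assume neg: "\<not> ?thesis"
    have der: "((\<lambda>\<eta>. u (aspiration h) \<eta> - S1 * \<eta>) has_real_derivative uy (aspiration h) h - S1 * 1) (at h within Y)"
      using aspiration_pos[OF assms(2)] assms(2)
      by (intro DERIV_diff u_deriv_y DERIV_cmult DERIV_ident) auto
    from neg obtain \<delta> where \<delta>: "\<delta> > 0" "\<And>\<epsilon>. \<epsilon> > 0 \<Longrightarrow> h + \<epsilon> \<in> Y \<Longrightarrow> \<epsilon> < \<delta> \<Longrightarrow>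
        u (aspiration h) h - S1 * h < u (aspiration h) (h + \<epsilon>) - S1 * (h + \<epsilon>)"
      using has_real_derivative_pos_inc_right[OF der] by auto
    obtain \<epsilon>\<^sub>0 where \<epsilon>\<^sub>0: "\<epsilon>\<^sub>0 > 0" "ball h \<epsilon>\<^sub>0 \<subseteq> Y"
      using open_Y assms(2) openE by blast
    define \<epsilon> where "\<epsilon> = min \<delta> \<epsilon>\<^sub>0 / 2"
    have \<epsilon>: "\<epsilon> > 0" "\<epsilon> < \<delta>" "h + \<epsilon> \<in> Y"
      using \<delta>(1) \<epsilon>\<^sub>0 by (auto simp: \<epsilon>_def subset_eq dist_real_def)
    have "(?V (h + \<epsilon>) - ?V h) * (h - ?m) < (S1 * \<epsilon>) * (h - ?m)"
      using V_slopes[OF m(1) assms(2) \<epsilon>(3) m(3)] \<epsilon>(1) unfolding S1 by (simp add: mult_ac)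
    then have "?V (h + \<epsilon>) - ?V h < S1 * \<epsilon>"
      using m(3) by (simp only: mult_less_cancel_right)
    moreover have "u (aspiration h) (h + \<epsilon>) \<le> ?V (h + \<epsilon>)" "?V h = u (aspiration h) h"
      using indirect_utility_ge[OF \<epsilon>(3)] aspiration_pos[OF assms(2)] indirect_utility_eq[OF assms(2)]
      by auto
    ultimately show False using \<delta>(2)[OF \<epsilon>(1,3,2)] by (simp add: algebra_simps)
  qed
  \<comment> \<open>The mirror image, with a small step to the left of l.\<close>
  moreover have "S2 \<le> uy (aspiration l) l"
  proof (rule ccontr)
    assume neg: "\<not> ?thesis"
    have der: "((\<lambda>\<eta>. S2 * \<eta> - u (aspiration l) \<eta>) has_real_derivative S2 * 1 - uy (aspiration l) l) (at l within Y)"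
      using aspiration_pos[OF assms(1)] assms(1)
      by (intro DERIV_diff u_deriv_y DERIV_cmult DERIV_ident) auto
    from neg obtain \<delta> where \<delta>: "\<delta> > 0" "\<And>\<epsilon>. \<epsilon> > 0 \<Longrightarrow> l - \<epsilon> \<in> Y \<Longrightarrow> \<epsilon> < \<delta> \<Longrightarrow>
        S2 * (l - \<epsilon>) - u (aspiration l) (l - \<epsilon>) < S2 * l - u (aspiration l) l"
      using has_real_derivative_pos_inc_left[OF der] by auto
    obtain \<epsilon>\<^sub>0 where \<epsilon>\<^sub>0: "\<epsilon>\<^sub>0 > 0" "ball l \<epsilon>\<^sub>0 \<subseteq> Y"
      using open_Y assms(1) openE by blast
    define \<epsilon> where "\<epsilon> = min \<delta> \<epsilon>\<^sub>0 / 2"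
    have \<epsilon>: "\<epsilon> > 0" "\<epsilon> < \<delta>" "l - \<epsilon> \<in> Y"
      using \<delta>(1) \<epsilon>\<^sub>0 by (auto simp: \<epsilon>_def subset_eq dist_real_def)
    have "(S2 * \<epsilon>) * (?m - l) < (?V l - ?V (l - \<epsilon>)) * (?m - l)"
      using V_slopes[OF \<epsilon>(3) assms(1) m(1) _ m(2)] \<epsilon>(1) unfolding S2 by (simp add: mult_ac)
    then have "S2 * \<epsilon> < ?V l - ?V (l - \<epsilon>)"
      using m(2) by (simp only: mult_less_cancel_right)
    moreover have "u (aspiration l) (l - \<epsilon>) \<le> ?V (l - \<epsilon>)" "?V l = u (aspiration l) l"
      using indirect_utility_ge[OF \<epsilon>(3)] aspiration_pos[OF assms(1)] indirect_utility_eq[OF assms(1)]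
      by auto
    ultimately show False using \<delta>(2)[OF \<epsilon>(1,3,2)] by (simp add: algebra_simps)
  qed
  ultimately show ?thesis using \<open>S1 < S2\<close> by linarith
qed

end

section \<open>The equilibrium of the four classes\<close>

text \<open>The classes with potentials \<open>h\<close>, \<open>h - t\<close>, \<open>l + t\<close>, \<open>l\<close> are called top, falling, rising and
  bottom; \<open>\<alpha>\<close> links top with rising and falling with bottom, \<open>\<beta>\<close> links top with falling and
  rising with bottom. At \<open>t = 0\<close> the comparison between rising and bottom is not yet binding.\<close>

locale four_classes = status_game +
  fixes l h \<alpha> \<beta> :: real
  assumes l_Y: "l \<in> Y" and h_Y: "h \<in> Y" and l_less_h: "l < h"
    and \<alpha>_nonneg: "\<alpha> \<ge> 0" and \<beta>_nonneg: "\<beta> \<ge> 0"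
begin

section \<open>Equilibrium consumption, solved from the top class downwards\<close>

abbreviation x_top :: real where "x_top \<equiv> aspiration h"

lemma in_Y: "\<eta> \<in> {l..h} \<Longrightarrow> \<eta> \<in> Y"
  using Icc_subset_Y[OF l_Y h_Y] by blast

text \<open>Intermediate value theorem between the bliss points of l and h: at the lower end both
  terms are nonnegative, while at \<open>x_top\<close> there is nobody left to envy and marginal
  utility is nonpositive.\<close>

lemma foc_root:
  assumes "\<eta> \<in> {l..h}" "\<And>z. isCont k z" "\<And>z. 0 \<le> k z" "k x_top = 0"
  shows "\<exists>x. x \<in> {aspiration l..x_top} \<and> ux x \<eta> + k x = 0"
proof -
  have "ux x_top \<eta> \<le> 0"
    using ux_mono_y[of x_top \<eta> h] aspiration_pos[OF h_Y] ux_aspiration[OF h_Y] in_Y h_Y assms(1) by auto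
  moreover have "0 \<le> ux (aspiration l) \<eta>"
    using ux_mono_y[of "aspiration l" l \<eta>] aspiration_pos[OF l_Y] ux_aspiration[OF l_Y] in_Y l_Y assms(1) by auto
  moreover have "continuous_on {aspiration l..x_top} (\<lambda>x. ux x \<eta> + k x)"
  proof (rule continuous_on_add)
    show "continuous_on {aspiration l..x_top} (\<lambda>x. ux x \<eta>)"
      using aspiration_pos[OF l_Y] in_Y[OF assms(1)]
      by (intro DERIV_continuous_on[where D = "\<lambda>x. uxx x \<eta>"] DERIV_subset[OF ux_deriv_x]) auto
    show "continuous_on {aspiration l..x_top} k"
      using assms(2) by (intro continuous_at_imp_continuous_on) auto
  qed
  ultimately show ?thesis
    using IVT2'[of "\<lambda>x. ux x \<eta> + k x" x_top 0 "aspiration l"] assms(3)[of "aspiration l"] assms(4)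
      aspiration_mono[OF l_Y h_Y] l_less_h
    by auto
qed

text \<open>The system is triangular: falling and rising look only at top, and bottom looks only at
  these two. Omitting the links down to bottom is justified by \<open>x_bottom_le_falling\<close>
  and \<open>x_bottom_le_rising\<close>, as \<open>p\<close> vanishes at nonpositive
  arguments.\<close>

definition x_falling :: "real \<Rightarrow> real" where
  "x_falling t = (SOME x. x \<in> {aspiration l..x_top} \<and> ux x (h - t) + \<beta> * p (x_top - x) = 0)"

definition x_rising :: "real \<Rightarrow> real" where
  "x_rising t = (SOME x. x \<in> {aspiration l..x_top} \<and> ux x (l + t) + \<alpha> * p (x_top - x) = 0)"

definition x_bottom :: "real \<Rightarrow> real" where
  "x_bottom t = (SOME x. x \<in> {aspiration l..x_top} \<and>
     ux x l + (\<alpha> * p (x_falling t - x) + \<beta> * p (x_rising t - x)) = 0)"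

lemma antimono_p_sum:
  "antimono (\<lambda>z. \<alpha> * p (c\<^sub>1 - z) + \<beta> * p (c\<^sub>2 - z))"
  using antimono_p[OF \<alpha>_nonneg] antimono_p[OF \<beta>_nonneg]
  by (auto simp: monotone_on_def intro!: add_mono)

context
  fixes t
  assumes t: "t \<in> {0..h - l}"
begin

lemma x_falling:
  shows x_falling_bounds: "x_falling t \<in> {aspiration l..x_top}"
    and x_falling_foc: "ux (x_falling t) (h - t) + \<beta> * p (x_top - x_falling t) = 0"
proof -
  have "x_falling t \<in> {aspiration l..x_top} \<and> ux (x_falling t) (h - t) + \<beta> * p (x_top - x_falling t) = 0"
    unfolding x_falling_def
    by (rule someI_ex, rule foc_root)
      (use t \<beta>_nonneg p_nonneg p_nonpos in \<open>auto intro!: continuous_intros isCont_o2[OF _ isCont_p]\<close>)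
  then show "x_falling t \<in> {aspiration l..x_top}"
    "ux (x_falling t) (h - t) + \<beta> * p (x_top - x_falling t) = 0" by blast+
qed

lemma x_rising:
  shows x_rising_bounds: "x_rising t \<in> {aspiration l..x_top}"
    and x_rising_foc: "ux (x_rising t) (l + t) + \<alpha> * p (x_top - x_rising t) = 0"
proof -
  have "x_rising t \<in> {aspiration l..x_top} \<and> ux (x_rising t) (l + t) + \<alpha> * p (x_top - x_rising t) = 0"
    unfolding x_rising_def
    by (rule someI_ex, rule foc_root)
      (use t \<alpha>_nonneg p_nonneg p_nonpos in \<open>auto intro!: continuous_intros isCont_o2[OF _ isCont_p]\<close>)
  then show "x_rising t \<in> {aspiration l..x_top}"
    "ux (x_rising t) (l + t) + \<alpha> * p (x_top - x_rising t) = 0" by blast+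
qed

lemma x_bottom:
  shows x_bottom_bounds: "x_bottom t \<in> {aspiration l..x_top}"
    and x_bottom_foc: "ux (x_bottom t) l
      + (\<alpha> * p (x_falling t - x_bottom t) + \<beta> * p (x_rising t - x_bottom t)) = 0"
proof -
  have "x_bottom t \<in> {aspiration l..x_top} \<and> ux (x_bottom t) l
      + (\<alpha> * p (x_falling t - x_bottom t) + \<beta> * p (x_rising t - x_bottom t)) = 0"
    unfolding x_bottom_def
    by (rule someI_ex, rule foc_root)
      (use t l_less_h \<alpha>_nonneg \<beta>_nonneg p_nonneg p_nonpos x_falling_bounds x_rising_bounds
        in \<open>auto intro!: continuous_intros isCont_o2[OF _ isCont_p]\<close>)
  then show "x_bottom t \<in> {aspiration l..x_top}"
    "ux (x_bottom t) l + (\<alpha> * p (x_falling t - x_bottom t) + \<beta> * p (x_rising t - x_bottom t)) = 0"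
    by blast+
qed

lemma x_pos: "0 < x_falling t" "0 < x_rising t" "0 < x_bottom t"
  using x_falling_bounds x_rising_bounds x_bottom_bounds aspiration_pos[OF l_Y] by auto

lemma potentials_in_Y: "h - t \<in> Y" "l + t \<in> Y"
  using t by (auto intro: in_Y)

text \<open>With weight \<alpha>, rising envies top where bottom envies only falling, and its
  potential is no lower. The extra \<beta> term in the second relief function vanishes at
  \<open>x_rising t\<close>, so the equation of rising is unchanged.\<close>

lemma x_bottom_le_rising: "x_bottom t \<le> x_rising t"
proof (rule foc_comparison[where \<eta>\<^sub>1 = l and \<eta>\<^sub>2 = "l + t"
      and k\<^sub>1 = "\<lambda>z. \<alpha> * p (x_falling t - z) + \<beta> * p (x_rising t - z)"
      and k\<^sub>2 = "\<lambda>z. \<alpha> * p (x_top - z) + \<beta> * p (x_rising t - z)"])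
  show "\<alpha> * p (x_falling t - x_bottom t) + \<beta> * p (x_rising t - x_bottom t)
      \<le> \<alpha> * p (x_top - x_bottom t) + \<beta> * p (x_rising t - x_bottom t)"
    using x_falling_bounds \<alpha>_nonneg by (intro add_right_mono mult_left_mono monoD[OF mono_p]) auto
qed (use x_pos potentials_in_Y l_Y t x_bottom_foc x_rising_foc p_nonpos antimono_p_sum in auto)

lemma x_bottom_le_falling: "x_bottom t \<le> x_falling t"
proof (rule foc_comparison[where \<eta>\<^sub>1 = l and \<eta>\<^sub>2 = "h - t"
      and k\<^sub>1 = "\<lambda>z. \<alpha> * p (x_falling t - z) + \<beta> * p (x_rising t - z)"
      and k\<^sub>2 = "\<lambda>z. \<alpha> * p (x_falling t - z) + \<beta> * p (x_top - z)"])
  show "\<alpha> * p (x_falling t - x_bottom t) + \<beta> * p (x_rising t - x_bottom t)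
      \<le> \<alpha> * p (x_falling t - x_bottom t) + \<beta> * p (x_top - x_bottom t)"
    using x_rising_bounds \<beta>_nonneg by (intro add_left_mono mult_left_mono monoD[OF mono_p]) auto
qed (use x_pos potentials_in_Y l_Y t x_bottom_foc x_falling_foc p_nonpos antimono_p_sum in auto)

end

section \<open>Utilities of the classes and deviations from equilibrium\<close>

definition U_falling :: "real \<Rightarrow> real" where
  "U_falling t = u (x_falling t) (h - t) - \<beta> * envy (x_top - x_falling t)"

definition U_rising :: "real \<Rightarrow> real" where
  "U_rising t = u (x_rising t) (l + t) - \<alpha> * envy (x_top - x_rising t)"

definition U_bottom :: "real \<Rightarrow> real" where
  "U_bottom t = u (x_bottom t) l
     - (\<alpha> * envy (x_falling t - x_bottom t) + \<beta> * envy (x_rising t - x_bottom t))"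

text \<open>Taking z to be the consumption at an earlier t bounds the new utility from below. This
  is the finite-difference half of the envelope theorem used for all three classes.\<close>

lemma U_falling_ge:
  assumes "t \<in> {0..h - l}" "0 \<le> z"
  shows "u z (h - t) - \<beta> * envy (x_top - z) \<le> U_falling t"
  unfolding U_falling_def
  using x_pos(1)[OF assms(1)] x_falling_foc[OF assms(1)]
  by (intro foc_imp_max[where k = "\<lambda>z. \<beta> * p (x_top - z)"] potentials_in_Y assms
      antimono_p \<beta>_nonneg DERIV_cmult[OF envy_deriv, THEN DERIV_cong]) auto

lemma U_rising_ge:
  assumes "t \<in> {0..h - l}" "0 \<le> z"
  shows "u z (l + t) - \<alpha> * envy (x_top - z) \<le> U_rising t"
  unfolding U_rising_def
  using x_pos(2)[OF assms(1)] x_rising_foc[OF assms(1)]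
  by (intro foc_imp_max[where k = "\<lambda>z. \<alpha> * p (x_top - z)"] potentials_in_Y assms
      antimono_p \<alpha>_nonneg DERIV_cmult[OF envy_deriv, THEN DERIV_cong]) auto

lemma U_bottom_ge:
  assumes "t \<in> {0..h - l}" "0 \<le> z"
  shows "u z l - (\<alpha> * envy (x_falling t - z) + \<beta> * envy (x_rising t - z)) \<le> U_bottom t"
  unfolding U_bottom_def
  using x_pos(3)[OF assms(1)] x_bottom_foc[OF assms(1)]
  by (intro foc_imp_max[where k = "\<lambda>z. \<alpha> * p (x_falling t - z) + \<beta> * p (x_rising t - z)"] l_Y assms
      antimono_p_sum DERIV_add[OF DERIV_cmult[OF envy_deriv] DERIV_cmult[OF envy_deriv], THEN DERIV_cong]) auto

section \<open>Response of consumption to the parameter t\<close>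

lemma x_falling_antimono:
  assumes "0 \<le> t\<^sub>1" "t\<^sub>1 \<le> t\<^sub>2" "t\<^sub>2 \<le> h - l"
  shows "x_falling t\<^sub>2 \<le> x_falling t\<^sub>1"
proof -
  have t: "t\<^sub>1 \<in> {0..h - l}" "t\<^sub>2 \<in> {0..h - l}" using assms by auto
  show ?thesis
    by (rule foc_comparison[where k\<^sub>1 = "\<lambda>z. \<beta> * p (x_top - z)" and k\<^sub>2 = "\<lambda>z. \<beta> * p (x_top - z)", OF x_pos(1)[OF t(2)] x_pos(1)[OF t(1)] potentials_in_Y(1)[OF t(2)]
          potentials_in_Y(1)[OF t(1)] _ x_falling_foc[OF t(2)] x_falling_foc[OF t(1)]])
      (use assms antimono_p \<beta>_nonneg in auto)
qed

lemma x_rising_mono: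
  assumes "0 \<le> t\<^sub>1" "t\<^sub>1 \<le> t\<^sub>2" "t\<^sub>2 \<le> h - l"
  shows "x_rising t\<^sub>1 \<le> x_rising t\<^sub>2"
proof -
  have t: "t\<^sub>1 \<in> {0..h - l}" "t\<^sub>2 \<in> {0..h - l}" using assms by auto
  show ?thesis
    by (rule foc_comparison[where k\<^sub>1 = "\<lambda>z. \<alpha> * p (x_top - z)" and k\<^sub>2 = "\<lambda>z. \<alpha> * p (x_top - z)", OF x_pos(2)[OF t(1)] x_pos(2)[OF t(2)] potentials_in_Y(2)[OF t(1)]
          potentials_in_Y(2)[OF t(2)] _ x_rising_foc[OF t(1)] x_rising_foc[OF t(2)]])
      (use assms antimono_p \<alpha>_nonneg in auto)
qed

text \<open>On the compact box of relevant consumptions and potentials the continuous functions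
  \<open>uxx\<close> and \<open>uxy\<close> attain their maxima, the former negative. This gives
  uniform strong concavity and a bounded effect of potentials.\<close>

lemma ux_quantitative:
  obtains \<kappa> M where "\<kappa> > 0" "M \<ge> 0"
    "\<And>x\<^sub>1 x\<^sub>2 \<eta>. aspiration l \<le> x\<^sub>1 \<Longrightarrow> x\<^sub>1 \<le> x\<^sub>2 \<Longrightarrow> x\<^sub>2 \<le> x_top \<Longrightarrow> \<eta> \<in> {l..h} \<Longrightarrow>
      \<kappa> * (x\<^sub>2 - x\<^sub>1) \<le> ux x\<^sub>1 \<eta> - ux x\<^sub>2 \<eta>"
    "\<And>x \<eta>\<^sub>1 \<eta>\<^sub>2. x \<in> {aspiration l..x_top} \<Longrightarrow> l \<le> \<eta>\<^sub>1 \<Longrightarrow> \<eta>\<^sub>1 \<le> \<eta>\<^sub>2 \<Longrightarrow> \<eta>\<^sub>2 \<le> h \<Longrightarrow>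
      ux x \<eta>\<^sub>2 - ux x \<eta>\<^sub>1 \<le> M * (\<eta>\<^sub>2 - \<eta>\<^sub>1)"
proof -
  let ?B = "{aspiration l..x_top} \<times> {l..h}"
  have sub: "?B \<subseteq> {0..} \<times> Y"
    using aspiration_pos[OF l_Y] in_Y by auto
  have B: "compact ?B" "?B \<noteq> {}"
    using l_less_h aspiration_mono[OF l_Y h_Y] by (auto intro: compact_Times)
  note cont = C1_partials_on_continuous[OF C1_ux, THEN continuous_on_subset, OF sub]
  obtain m where m: "m \<in> ?B" "\<And>z. z \<in> ?B \<Longrightarrow> uxx (fst z) (snd z) \<le> uxx (fst m) (snd m)"
    using continuous_attains_sup[OF B cont(1)] by blast
  obtain n where n: "n \<in> ?B" "\<And>z. z \<in> ?B \<Longrightarrow> uxy (fst z) (snd z) \<le> uxy (fst n) (snd n)"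
    using continuous_attains_sup[OF B cont(2)] by blast
  show ?thesis
  proof
    show "- uxx (fst m) (snd m) > 0"
      using uxx_neg[of "fst m" "snd m"] m(1) sub by auto
    have "fst n > 0" "snd n \<in> Y"
      using n(1) aspiration_pos[OF l_Y] in_Y by auto
    then show "uxy (fst n) (snd n) \<ge> 0"
      using uxy_pos less_imp_le by blast
    show "- uxx (fst m) (snd m) * (x\<^sub>2 - x\<^sub>1) \<le> ux x\<^sub>1 \<eta> - ux x\<^sub>2 \<eta>"
      if *: "aspiration l \<le> x\<^sub>1" "x\<^sub>1 \<le> x\<^sub>2" "x\<^sub>2 \<le> x_top" "\<eta> \<in> {l..h}" for x\<^sub>1 x\<^sub>2 \<eta>
    proof -
      obtain x where x: "x \<in> {x\<^sub>1..x\<^sub>2}" "ux x\<^sub>2 \<eta> - ux x\<^sub>1 \<eta> = uxx x \<eta> * (x\<^sub>2 - x\<^sub>1)"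
        by (rule ux_mvt_x[of x\<^sub>1 x\<^sub>2 \<eta>]) (use * in_Y aspiration_pos[OF l_Y] in auto)
      have "uxx x \<eta> * (x\<^sub>2 - x\<^sub>1) \<le> uxx (fst m) (snd m) * (x\<^sub>2 - x\<^sub>1)"
        using m(2)[of "(x, \<eta>)"] x(1) that by (intro mult_right_mono) auto
      then show ?thesis using x(2) by simp
    qed
    show "ux x \<eta>\<^sub>2 - ux x \<eta>\<^sub>1 \<le> uxy (fst n) (snd n) * (\<eta>\<^sub>2 - \<eta>\<^sub>1)"
      if *: "x \<in> {aspiration l..x_top}" "l \<le> \<eta>\<^sub>1" "\<eta>\<^sub>1 \<le> \<eta>\<^sub>2" "\<eta>\<^sub>2 \<le> h" for x \<eta>\<^sub>1 \<eta>\<^sub>2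
    proof -
      obtain \<eta> where \<eta>: "\<eta> \<in> {\<eta>\<^sub>1..\<eta>\<^sub>2}" "ux x \<eta>\<^sub>2 - ux x \<eta>\<^sub>1 = uxy x \<eta> * (\<eta>\<^sub>2 - \<eta>\<^sub>1)"
        by (rule ux_mvt_y[of x \<eta>\<^sub>1 \<eta>\<^sub>2]) (use * in_Y aspiration_pos[OF l_Y] in auto)
      have "uxy x \<eta> * (\<eta>\<^sub>2 - \<eta>\<^sub>1) \<le> uxy (fst n) (snd n) * (\<eta>\<^sub>2 - \<eta>\<^sub>1)"
        using n(2)[of "(x, \<eta>)"] \<eta>(1) that by (intro mult_right_mono) auto
      then show ?thesis using \<eta>(2) by simp
    qed
  qed
qed

text \<open>Subtract the first-order conditions at the two parameters. Relief from envy shrinks as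
  consumption rises, so strong concavity leaves only the direct effect of the potential.\<close>

lemma x_rising_lipschitz:
  obtains C where "C \<ge> 0" "\<And>t\<^sub>1 t\<^sub>2. 0 \<le> t\<^sub>1 \<Longrightarrow> t\<^sub>1 \<le> t\<^sub>2 \<Longrightarrow> t\<^sub>2 \<le> h - l \<Longrightarrow>
    x_rising t\<^sub>2 - x_rising t\<^sub>1 \<le> C * (t\<^sub>2 - t\<^sub>1)"
proof -
  obtain \<kappa> M where \<kappa>: "\<kappa> > 0" and M: "M \<ge> 0"
    and k: "\<And>x\<^sub>1 x\<^sub>2 \<eta>. aspiration l \<le> x\<^sub>1 \<Longrightarrow> x\<^sub>1 \<le> x\<^sub>2 \<Longrightarrow> x\<^sub>2 \<le> x_top \<Longrightarrow> \<eta> \<in> {l..h} \<Longrightarrow>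
      \<kappa> * (x\<^sub>2 - x\<^sub>1) \<le> ux x\<^sub>1 \<eta> - ux x\<^sub>2 \<eta>"
    and m: "\<And>x \<eta>\<^sub>1 \<eta>\<^sub>2. x \<in> {aspiration l..x_top} \<Longrightarrow> l \<le> \<eta>\<^sub>1 \<Longrightarrow> \<eta>\<^sub>1 \<le> \<eta>\<^sub>2 \<Longrightarrow> \<eta>\<^sub>2 \<le> h \<Longrightarrow>
      ux x \<eta>\<^sub>2 - ux x \<eta>\<^sub>1 \<le> M * (\<eta>\<^sub>2 - \<eta>\<^sub>1)"
    by (rule ux_quantitative) blast
  show ?thesis
  proof
    show "M / \<kappa> \<ge> 0" using \<kappa> M by simp
    fix t\<^sub>1 t\<^sub>2 assume *: "0 \<le> t\<^sub>1" "t\<^sub>1 \<le> t\<^sub>2" "t\<^sub>2 \<le> h - l"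
    then have t: "t\<^sub>1 \<in> {0..h - l}" "t\<^sub>2 \<in> {0..h - l}" by auto
    let ?x1 = "x_rising t\<^sub>1" and ?x2 = "x_rising t\<^sub>2"
    have le: "?x1 \<le> ?x2" by (rule x_rising_mono[OF *])
    have "\<kappa> * (?x2 - ?x1) \<le> ux ?x1 (l + t\<^sub>1) - ux ?x2 (l + t\<^sub>1)"
      using k le x_rising_bounds[OF t(1)] x_rising_bounds[OF t(2)] * by auto
    moreover have "\<alpha> * p (x_top - ?x2) \<le> \<alpha> * p (x_top - ?x1)"
      using le \<alpha>_nonneg by (intro mult_left_mono monoD[OF mono_p]) auto
    moreover have "ux ?x2 (l + t\<^sub>2) - ux ?x2 (l + t\<^sub>1) \<le> M * (t\<^sub>2 - t\<^sub>1)"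
      using m[of ?x2 "l + t\<^sub>1" "l + t\<^sub>2"] x_rising_bounds[OF t(2)] * by auto
    ultimately have "\<kappa> * (?x2 - ?x1) \<le> M * (t\<^sub>2 - t\<^sub>1)"
      using x_rising_foc[OF t(1)] x_rising_foc[OF t(2)] by linarith
    then show "?x2 - ?x1 \<le> M / \<kappa> * (t\<^sub>2 - t\<^sub>1)"
      using \<kappa> by (simp add: field_simps)
  qed
qed

text \<open>Bottom differs from rising by a potential gap t and by envying falling instead of top.
  Both differences are of order t, and strong concavity carries this over to consumption.\<close>

lemma rising_bottom_gap:
  obtains C where "C \<ge> 0" "\<And>t. t \<in> {0..h - l} \<Longrightarrow> x_rising t - x_bottom t \<le> C * t"
proof -
  obtain \<kappa> M where \<kappa>: "\<kappa> > 0" and M: "M \<ge> 0"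
    and k: "\<And>x\<^sub>1 x\<^sub>2 \<eta>. aspiration l \<le> x\<^sub>1 \<Longrightarrow> x\<^sub>1 \<le> x\<^sub>2 \<Longrightarrow> x\<^sub>2 \<le> x_top \<Longrightarrow> \<eta> \<in> {l..h} \<Longrightarrow>
      \<kappa> * (x\<^sub>2 - x\<^sub>1) \<le> ux x\<^sub>1 \<eta> - ux x\<^sub>2 \<eta>"
    and m: "\<And>x \<eta>\<^sub>1 \<eta>\<^sub>2. x \<in> {aspiration l..x_top} \<Longrightarrow> l \<le> \<eta>\<^sub>1 \<Longrightarrow> \<eta>\<^sub>1 \<le> \<eta>\<^sub>2 \<Longrightarrow> \<eta>\<^sub>2 \<le> h \<Longrightarrow>
      ux x \<eta>\<^sub>2 - ux x \<eta>\<^sub>1 \<le> M * (\<eta>\<^sub>2 - \<eta>\<^sub>1)"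
    by (rule ux_quantitative) blast
  obtain L where L: "L \<ge> 0" "\<And>r s. r \<le> s \<Longrightarrow> s \<le> x_top - aspiration l \<Longrightarrow> p s - p r \<le> L * (s - r)"
    using p_lipschitz by blast
  show ?thesis
  proof
    show "(M + \<alpha> * L * (M / \<kappa>)) / \<kappa> \<ge> 0"
      using \<kappa> M L \<alpha>_nonneg by simp
    fix t assume t: "t \<in> {0..h - l}"
    let ?F = "x_falling t" and ?R = "x_rising t" and ?B = "x_bottom t"
    note b = x_falling_bounds[OF t] x_rising_bounds[OF t] x_bottom_bounds[OF t]
    \<comment> \<open>First, falling stays within order t of top, since its potential is only t
      lower and envy can only raise its consumption.\<close>
    have "\<kappa> * (x_top - ?F) \<le> ux ?F (h - t) - ux x_top (h - t)"
      using k b t by auto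
    moreover have "ux x_top h - ux x_top (h - t) \<le> M * t"
      using m[of x_top "h - t" h] t aspiration_mono[OF l_Y h_Y] l_less_h by auto
    moreover have "ux ?F (h - t) \<le> 0"
      using x_falling_foc[OF t] mult_nonneg_nonneg[OF \<beta>_nonneg p_nonneg[of "x_top - ?F"]] by linarith
    ultimately have "\<kappa> * (x_top - ?F) \<le> M * t"
      using ux_aspiration[OF h_Y] by linarith
    then have falling: "x_top - ?F \<le> M / \<kappa> * t"
      using \<kappa> by (simp add: field_simps)
    have "\<kappa> * (?R - ?B) \<le> ux ?B l - ux ?R l"
      using k[of ?B ?R l] b x_bottom_le_rising[OF t] l_less_h by auto
    moreover have "ux ?R (l + t) - ux ?R l \<le> M * t"
      using m[of ?R l "l + t"] b t by auto
    \<comment> \<open>Replacing \<open>?B\<close> by the larger \<open>?R\<close> in the second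
      argument lowers that relief, leaving an increment of \<open>p\<close> over the distance
      between falling and top.\<close>
    moreover have "\<alpha> * p (x_top - ?R) - \<alpha> * p (?F - ?B) \<le> \<alpha> * L * (M / \<kappa>) * t"
    proof -
      have "p (x_top - ?R) - p (?F - ?R) \<le> L * (x_top - ?F)"
        using L(2)[of "?F - ?R" "x_top - ?R"] b by auto
      also have "\<dots> \<le> L * (M / \<kappa> * t)"
        using falling L(1) by (rule mult_left_mono)
      finally have "p (x_top - ?R) - p (?F - ?B) \<le> L * (M / \<kappa> * t)"
        using monoD[OF mono_p, of "?F - ?R" "?F - ?B"] x_bottom_le_rising[OF t] by linarith
      then have "\<alpha> * (p (x_top - ?R) - p (?F - ?B)) \<le> \<alpha> * (L * (M / \<kappa> * t))"
        using \<alpha>_nonneg by (rule mult_left_mono)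
      then show ?thesis by (simp add: algebra_simps)
    qed
    moreover have "0 \<le> \<beta> * p (?R - ?B)"
      using \<beta>_nonneg p_nonneg by simp
    ultimately have "\<kappa> * (?R - ?B) \<le> M * t + \<alpha> * L * (M / \<kappa>) * t"
      using x_rising_foc[OF t] x_bottom_foc[OF t] by linarith
    also have "\<dots> = (M + \<alpha> * L * (M / \<kappa>)) * t" by (simp only: distrib_right)
    finally show "?R - ?B \<le> (M + \<alpha> * L * (M / \<kappa>)) / \<kappa> * t"
      using \<kappa> by (simp add: pos_le_divide_eq mult.commute)
  qed
qed

section \<open>Growth of the class utilities for small t\<close>

lemma U_bottom_growth:
  assumes "\<epsilon> > 0"
  obtains t\<^sub>0 where "t\<^sub>0 > 0" "t\<^sub>0 \<le> h - l"
    "\<And>t\<^sub>1 t\<^sub>2. 0 \<le> t\<^sub>1 \<Longrightarrow> t\<^sub>1 \<le> t\<^sub>2 \<Longrightarrow> t\<^sub>2 < t\<^sub>0 \<Longrightarrow> - \<epsilon> * (t\<^sub>2 - t\<^sub>1) \<le> U_bottom t\<^sub>2 - U_bottom t\<^sub>1"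
proof -
  obtain C1 where C1: "C1 \<ge> 0" "\<And>t\<^sub>1 t\<^sub>2. 0 \<le> t\<^sub>1 \<Longrightarrow> t\<^sub>1 \<le> t\<^sub>2 \<Longrightarrow> t\<^sub>2 \<le> h - l \<Longrightarrow>
    x_rising t\<^sub>2 - x_rising t\<^sub>1 \<le> C1 * (t\<^sub>2 - t\<^sub>1)"
    by (rule x_rising_lipschitz) blast
  obtain C2 where C2: "C2 \<ge> 0" "\<And>t. t \<in> {0..h - l} \<Longrightarrow> x_rising t - x_bottom t \<le> C2 * t"
    by (rule rising_bottom_gap) blast
  obtain L where L: "L \<ge> 0" "\<And>r s. r \<le> s \<Longrightarrow> s \<le> (C1 + C2) * (h - l) \<Longrightarrow> p s - p r \<le> L * (s - r)"
    using p_lipschitz by blast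
  \<comment> \<open>The loss from the rise of rising turns out to be at most
    \<open>D * t\<^sub>2 * (t\<^sub>2 - t\<^sub>1)\<close>. Dividing \<epsilon> by D + 1 also covers
    D = 0.\<close>
  define D where "D = \<beta> * L * (C1 + C2) * C1"
  have D: "D \<ge> 0" using \<beta>_nonneg L(1) C1(1) C2(1) by (simp add: D_def)
  show ?thesis
  proof
    show "min (h - l) (\<epsilon> / (D + 1)) > 0" "min (h - l) (\<epsilon> / (D + 1)) \<le> h - l"
      using l_less_h assms D by auto
    fix t\<^sub>1 t\<^sub>2 assume *: "0 \<le> t\<^sub>1" "t\<^sub>1 \<le> t\<^sub>2" "t\<^sub>2 < min (h - l) (\<epsilon> / (D + 1))"
    then have t: "t\<^sub>1 \<in> {0..h - l}" "t\<^sub>2 \<in> {0..h - l}" by auto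
    have "t\<^sub>2 * (D + 1) \<le> \<epsilon>"
      using * D by (simp add: pos_less_divide_eq less_imp_le)
    then have small: "D * t\<^sub>2 \<le> \<epsilon>" using * by (simp add: algebra_simps)
    \<comment> \<open>Bottom keeps its old consumption. The fall of falling can only help it, so
      just the envy of rising must be estimated.\<close>
    let ?z = "x_bottom t\<^sub>1"
    let ?r1 = "x_rising t\<^sub>1 - ?z" and ?r2 = "x_rising t\<^sub>2 - ?z"
    have le: "?r1 \<le> ?r2" using x_rising_mono[of t\<^sub>1 t\<^sub>2] * by simp
    have diff: "?r2 - ?r1 \<le> C1 * (t\<^sub>2 - t\<^sub>1)" using C1(2)[of t\<^sub>1 t\<^sub>2] * by simp
    have "?r2 \<le> C1 * (t\<^sub>2 - t\<^sub>1) + C2 * t\<^sub>1" using diff C2(2)[OF t(1)] by linarith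
    also have "\<dots> \<le> C1 * t\<^sub>2 + C2 * t\<^sub>2"
      using C1(1) C2(1) * by (intro add_mono mult_left_mono) auto
    finally have r2: "?r2 \<le> (C1 + C2) * t\<^sub>2" by (simp add: algebra_simps)
    have r2_nonneg: "0 \<le> ?r2" using le x_bottom_le_rising[OF t(1)] by linarith
    obtain w where w: "?r1 \<le> w" "w \<le> ?r2" "envy ?r2 - envy ?r1 = p w * (?r2 - ?r1)"
      using envy_mvt[OF le] by blast
    \<comment> \<open>The distance to rising is of order \<open>t\<^sub>2\<close>, and
      \<open>p 0 = 0\<close> makes the marginal penalty of the same order; this is the second-order
      smallness.\<close>
    have "p w \<le> p ((C1 + C2) * t\<^sub>2)" using w(2) r2 by (intro monoD[OF mono_p]) linarith
    also have "\<dots> \<le> L * ((C1 + C2) * t\<^sub>2)"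
      using L(2)[of 0 "(C1 + C2) * t\<^sub>2"] p_nonpos[of 0] t(2) C1(1) C2(1) by (simp add: mult_left_mono)
    finally have pw: "p w \<le> L * ((C1 + C2) * t\<^sub>2)" .
    have "envy ?r2 - envy ?r1 \<le> L * ((C1 + C2) * t\<^sub>2) * (C1 * (t\<^sub>2 - t\<^sub>1))"
      unfolding w(3) using pw diff le L(1) C1(1) C2(1) t(2) by (intro mult_mono) auto
    then have "\<beta> * (envy ?r2 - envy ?r1) \<le> \<beta> * (L * ((C1 + C2) * t\<^sub>2) * (C1 * (t\<^sub>2 - t\<^sub>1)))"
      using \<beta>_nonneg by (rule mult_left_mono)
    also have "\<dots> = D * t\<^sub>2 * (t\<^sub>2 - t\<^sub>1)" by (simp only: D_def mult_ac)
    also have "\<dots> \<le> \<epsilon> * (t\<^sub>2 - t\<^sub>1)" using small * by (intro mult_right_mono) auto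
    finally have rising: "\<beta> * envy ?r2 - \<beta> * envy ?r1 \<le> \<epsilon> * (t\<^sub>2 - t\<^sub>1)"
      by (simp only: right_diff_distrib)
    have "x_falling t\<^sub>2 \<le> x_falling t\<^sub>1" using x_falling_antimono[of t\<^sub>1 t\<^sub>2] * by simp
    then have "\<alpha> * envy (x_falling t\<^sub>2 - ?z) \<le> \<alpha> * envy (x_falling t\<^sub>1 - ?z)"
      using \<alpha>_nonneg by (intro mult_left_mono envy_mono) auto
    then show "- \<epsilon> * (t\<^sub>2 - t\<^sub>1) \<le> U_bottom t\<^sub>2 - U_bottom t\<^sub>1"
      using rising U_bottom_ge[OF t(2), of ?z] x_pos(3)[OF t(1)] unfolding U_bottom_def[of t\<^sub>1] by linarith
  qed
qed

text \<open>Supermodularity moves the envelope bounds to the fixed consumptions \<open>x_top\<close> and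
  \<open>aspiration l\<close>, so no limits of the equilibrium consumptions are needed.\<close>

lemma U_falling_rising_growth:
  obtains K1 K2 t\<^sub>0 where "0 \<le> K1" "K1 < K2" "t\<^sub>0 > 0" "t\<^sub>0 \<le> h - l"
    "\<And>t\<^sub>1 t\<^sub>2. 0 \<le> t\<^sub>1 \<Longrightarrow> t\<^sub>1 \<le> t\<^sub>2 \<Longrightarrow> t\<^sub>2 < t\<^sub>0 \<Longrightarrow> - K1 * (t\<^sub>2 - t\<^sub>1) \<le> U_falling t\<^sub>2 - U_falling t\<^sub>1"
    "\<And>t\<^sub>1 t\<^sub>2. 0 \<le> t\<^sub>1 \<Longrightarrow> t\<^sub>1 \<le> t\<^sub>2 \<Longrightarrow> t\<^sub>2 < t\<^sub>0 \<Longrightarrow> K2 * (t\<^sub>2 - t\<^sub>1) \<le> U_rising t\<^sub>2 - U_rising t\<^sub>1"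
proof -
  let ?a = "aspiration l"
  have pos: "?a > 0" "x_top > 0" using aspiration_pos l_Y h_Y by auto
  \<comment> \<open>K1 bounds the loss rate of falling and K2 the gain rate of rising; both fit into
    the gap opened by the envelope comparison.\<close>
  obtain K1 where K1: "uy x_top h < K1" "K1 < uy ?a l"
    using dense uy_aspiration_less[OF l_Y h_Y l_less_h] by blast
  obtain K2 where K2: "K1 < K2" "K2 < uy ?a l"
    using dense K1(2) by blast
  have K1_nonneg: "0 \<le> K1" using uy_pos[of x_top h] pos h_Y K1(1) by simp
  have cont: "continuous_on Y (uy x)" if "x \<ge> 0" for x
  proof -
    have "continuous_on Y (\<lambda>y. (x, y))" "(\<lambda>y. (x, y)) ` Y \<subseteq> {0..} \<times> Y"
      using that by (auto intro!: continuous_intros)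
    from continuous_on_compose2[OF C1_partials_on_continuous(2)[OF C1_u] this]
    show ?thesis by simp
  qed
  have "isCont (uy x_top) h" "isCont (uy ?a) l"
    using cont pos l_Y h_Y open_Y by (auto simp: continuous_on_eq_continuous_at)
  then have "\<forall>\<^sub>F \<eta> in nhds h. uy x_top \<eta> < K1" "\<forall>\<^sub>F \<eta> in nhds l. K2 < uy ?a \<eta>"
    using K1(1) K2(2) unfolding isCont_def tendsto_at_iff_tendsto_nhds
    by (auto dest: order_tendstoD)
  then obtain \<delta>1 \<delta>2 where \<delta>: "\<delta>1 > 0" "\<delta>2 > 0"
    "\<And>\<eta>. dist \<eta> h < \<delta>1 \<Longrightarrow> uy x_top \<eta> < K1" "\<And>\<eta>. dist \<eta> l < \<delta>2 \<Longrightarrow> K2 < uy ?a \<eta>"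
    unfolding eventually_nhds_metric by blast
  define t\<^sub>0 where "t\<^sub>0 = min (h - l) (min \<delta>1 \<delta>2)"
  have t\<^sub>0: "t\<^sub>0 > 0" "t\<^sub>0 \<le> h - l" "t\<^sub>0 \<le> \<delta>1" "t\<^sub>0 \<le> \<delta>2"
    using \<delta>(1,2) l_less_h by (auto simp: t\<^sub>0_def)
  have "- K1 * (t\<^sub>2 - t\<^sub>1) \<le> U_falling t\<^sub>2 - U_falling t\<^sub>1"
    if *: "0 \<le> t\<^sub>1" "t\<^sub>1 \<le> t\<^sub>2" "t\<^sub>2 < t\<^sub>0" for t\<^sub>1 t\<^sub>2
  proof -
    have t: "t\<^sub>1 \<in> {0..h - l}" "t\<^sub>2 \<in> {0..h - l}" using that t\<^sub>0 by auto
    let ?x = "x_falling t\<^sub>1"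
    have Y: "h - t\<^sub>1 \<in> Y" "h - t\<^sub>2 \<in> Y" using potentials_in_Y t by auto
    obtain \<eta> where \<eta>: "\<eta> \<in> {h - t\<^sub>2..h - t\<^sub>1}" "\<eta> \<in> Y"
      "u x_top (h - t\<^sub>1) - u x_top (h - t\<^sub>2) = uy x_top \<eta> * ((h - t\<^sub>1) - (h - t\<^sub>2))"
      using u_mvt_y[of x_top "h - t\<^sub>2" "h - t\<^sub>1"] pos Y * by auto
    have "uy x_top \<eta> \<le> K1"
      using \<delta>(3)[of \<eta>] \<eta>(1) * t\<^sub>0 by (auto simp: dist_real_def)
    then have "uy x_top \<eta> * ((h - t\<^sub>1) - (h - t\<^sub>2)) \<le> K1 * ((h - t\<^sub>1) - (h - t\<^sub>2))"
      using * by (intro mult_right_mono) auto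
    also have "\<dots> = K1 * (t\<^sub>2 - t\<^sub>1)" by simp
    finally have "u x_top (h - t\<^sub>1) - u x_top (h - t\<^sub>2) \<le> K1 * (t\<^sub>2 - t\<^sub>1)"
      using \<eta>(3) by simp
    moreover have "u ?x (h - t\<^sub>1) - u ?x (h - t\<^sub>2) \<le> u x_top (h - t\<^sub>1) - u x_top (h - t\<^sub>2)"
      using u_supermodular[of ?x x_top] x_pos(1)[OF t(1)] x_falling_bounds[OF t(1)] Y * by auto
    moreover have "u ?x (h - t\<^sub>2) - \<beta> * envy (x_top - ?x) \<le> U_falling t\<^sub>2"
      using U_falling_ge[OF t(2)] x_pos(1)[OF t(1)] by simp
    ultimately show ?thesis unfolding U_falling_def[of t\<^sub>1] by linarith
  qed
  moreover have "K2 * (t\<^sub>2 - t\<^sub>1) \<le> U_rising t\<^sub>2 - U_rising t\<^sub>1"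
    if *: "0 \<le> t\<^sub>1" "t\<^sub>1 \<le> t\<^sub>2" "t\<^sub>2 < t\<^sub>0" for t\<^sub>1 t\<^sub>2
  proof -
    have t: "t\<^sub>1 \<in> {0..h - l}" "t\<^sub>2 \<in> {0..h - l}" using that t\<^sub>0 by auto
    let ?x = "x_rising t\<^sub>1"
    have Y: "l + t\<^sub>1 \<in> Y" "l + t\<^sub>2 \<in> Y" using potentials_in_Y t by auto
    obtain \<eta> where \<eta>: "\<eta> \<in> {l + t\<^sub>1..l + t\<^sub>2}" "\<eta> \<in> Y"
      "u ?a (l + t\<^sub>2) - u ?a (l + t\<^sub>1) = uy ?a \<eta> * ((l + t\<^sub>2) - (l + t\<^sub>1))"
      using u_mvt_y[of ?a "l + t\<^sub>1" "l + t\<^sub>2"] pos Y * by auto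
    have "K2 \<le> uy ?a \<eta>"
      using \<delta>(4)[of \<eta>] \<eta>(1) * t\<^sub>0 by (auto simp: dist_real_def)
    then have "K2 * (t\<^sub>2 - t\<^sub>1) \<le> uy ?a \<eta> * ((l + t\<^sub>2) - (l + t\<^sub>1))"
      using * by (auto intro: mult_right_mono)
    moreover have "u ?a (l + t\<^sub>2) - u ?a (l + t\<^sub>1) \<le> u ?x (l + t\<^sub>2) - u ?x (l + t\<^sub>1)"
      using u_supermodular[of ?a ?x] pos x_rising_bounds[OF t(1)] Y * by auto
    moreover have "u ?x (l + t\<^sub>2) - \<alpha> * envy (x_top - ?x) \<le> U_rising t\<^sub>2"
      using U_rising_ge[OF t(2)] x_pos(2)[OF t(1)] by simp
    ultimately show ?thesis using \<eta>(3) unfolding U_rising_def[of t\<^sub>1] by linarith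
  qed
  ultimately show ?thesis using that K1_nonneg K2(1) t\<^sub>0(1,2) by blast
qed

text \<open>V at the midpoint of l and h separates the two: rising has a potential below the
  midpoint, while falling could consume \<open>x_top\<close>, envy nobody, and get close to
  \<open>u x_top h\<close>.\<close>

lemma U_rising_less_falling:
  obtains t\<^sub>0 where "t\<^sub>0 > 0" "\<And>t. t \<in> {0..h - l} \<Longrightarrow> t < t\<^sub>0 \<Longrightarrow> U_rising t < U_falling t"
proof -
  let ?m = "(l + h) / 2" and ?V = "indirect_utility u"
  have m: "?m \<in> Y" "?m < h" using in_Y l_less_h by auto
  have "?V ?m < u x_top h"
    using u_strict_mono_y[of "aspiration ?m" ?m h] aspiration_max[OF h_Y, of "aspiration ?m"]
      aspiration_pos[OF m(1)] indirect_utility_eq[OF m(1)] m h_Y by auto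
  moreover have "isCont (u x_top) h"
    using u_deriv_y[of x_top h] aspiration_pos[OF h_Y] h_Y at_within_open[OF h_Y open_Y]
    by (auto intro: DERIV_isCont)
  ultimately have "\<forall>\<^sub>F \<eta> in nhds h. ?V ?m < u x_top \<eta>"
    unfolding isCont_def tendsto_at_iff_tendsto_nhds by (auto dest: order_tendstoD)
  then obtain \<delta> where \<delta>: "\<delta> > 0" "\<And>\<eta>. dist \<eta> h < \<delta> \<Longrightarrow> ?V ?m < u x_top \<eta>"
    unfolding eventually_nhds_metric by blast
  show ?thesis
  proof
    show "min \<delta> (h - ?m) > 0" using \<delta>(1) m(2) by simp
    fix t assume t: "t \<in> {0..h - l}" and "t < min \<delta> (h - ?m)"
    then have t': "t < \<delta>" "l + t < ?m" by (auto simp: field_simps)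
    have "0 \<le> \<alpha> * envy (x_top - x_rising t)"
      using \<alpha>_nonneg envy_mono[of 0 "x_top - x_rising t"] F_0 x_rising_bounds[OF t] by simp
    then have "U_rising t \<le> u (x_rising t) (l + t)"
      by (simp add: U_rising_def)
    also have "\<dots> < u (x_rising t) ?m"
      using u_strict_mono_y x_pos(2)[OF t] potentials_in_Y[OF t] m t' by auto
    also have "\<dots> \<le> ?V ?m" using indirect_utility_ge[OF m(1)] x_pos(2)[OF t] by simp
    also have "\<dots> < u x_top (h - t)"
      using \<delta>(2)[of "h - t"] t t' by (simp add: dist_real_def)
    also have "\<dots> \<le> U_falling t"
      using U_falling_ge[OF t, of x_top] F_0 aspiration_pos[OF h_Y] by simp
    finally show "U_rising t < U_falling t" .
  qed
qed

end

section \<open>Welfare\<close>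

text \<open>If the richer agent had the larger derivative, a small transfer to the poorer one would
  strictly lower W.\<close>

lemma pigou_dalton_gradient:
  fixes W :: "real^'n::finite \<Rightarrow> real"
  assumes PD: "pigou_dalton W" and W: "GDERIV W U :> D" and less: "U $ j < U $ i"
  shows "D $ i \<le> D $ j"
proof (rule ccontr)
  assume "\<not> D $ i \<le> D $ j"
  define v :: "real^'n" where "v = axis j 1 - axis i 1"
  have "i \<noteq> j" using less by auto
  have "((\<lambda>\<epsilon>. W (U + \<epsilon> *\<^sub>R v)) has_derivative (\<lambda>\<epsilon>. inner (\<epsilon> *\<^sub>R v) D)) (at 0)"
  proof (rule has_derivative_compose[where f = "\<lambda>\<epsilon>. U + \<epsilon> *\<^sub>R v"])
    show "((\<lambda>\<epsilon>. U + \<epsilon> *\<^sub>R v) has_derivative (\<lambda>\<epsilon>. \<epsilon> *\<^sub>R v)) (at 0)"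
      by (auto intro!: derivative_eq_intros)
    show "(W has_derivative (\<lambda>h. inner h D)) (at (U + 0 *\<^sub>R v))"
      using W by (simp add: gderiv_def)
  qed
  then have "((\<lambda>\<epsilon>. W (U + \<epsilon> *\<^sub>R v)) has_real_derivative (D $ j - D $ i)) (at 0)"
    by (simp add: has_field_derivative_def v_def inner_diff_left inner_axis' mult_commute_abs)
  then obtain \<delta> where \<delta>: "\<delta> > 0" "\<And>\<epsilon>. 0 < \<epsilon> \<Longrightarrow> \<epsilon> < \<delta> \<Longrightarrow> W (U + (0 + \<epsilon>) *\<^sub>R v) < W (U + 0 *\<^sub>R v)"
    using DERIV_neg_dec_right \<open>\<not> D $ i \<le> D $ j\<close> by (metis diff_less_0_iff_less not_le)
  \<comment> \<open>A transfer of at most half the utility gap does not reverse the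
    ordering.\<close>
  define \<epsilon> where "\<epsilon> = min \<delta> (U $ i - U $ j) / 2"
  have \<epsilon>: "0 < \<epsilon>" "\<epsilon> < \<delta>" "U $ i - \<epsilon> \<ge> U $ j + \<epsilon>"
    using \<delta>(1) less by (auto simp: \<epsilon>_def min_def field_simps)
  have "W U \<le> W (\<chi> k. if k = i then U $ i - \<epsilon> else if k = j then U $ j + \<epsilon> else U $ k)"
    using PD less \<epsilon>(1,3) unfolding pigou_dalton_def by blast
  also have "(\<chi> k. if k = i then U $ i - \<epsilon> else if k = j then U $ j + \<epsilon> else U $ k) = U + \<epsilon> *\<^sub>R v"
    using \<open>i \<noteq> j\<close> by (auto simp: vec_eq_iff v_def axis_def)
  finally show False using \<delta>(2)[OF \<epsilon>(1,2)] by simp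
qed

lemma GDERIV_mvt:
  assumes W: "\<And>U. GDERIV W U :> gradW U"
  obtains \<theta> where "0 < \<theta>" "\<theta> < 1" "W V - W U = inner (V - U) (gradW (U + \<theta> *\<^sub>R (V - U)))"
proof -
  have "((\<lambda>\<theta>. W (U + \<theta> *\<^sub>R (V - U))) has_derivative (\<lambda>h. inner (h *\<^sub>R (V - U)) (gradW (U + \<theta> *\<^sub>R (V - U))))) (at \<theta>)"
    for \<theta>
  proof (rule has_derivative_compose[where f = "\<lambda>\<theta>. U + \<theta> *\<^sub>R (V - U)"])
    show "((\<lambda>\<theta>. U + \<theta> *\<^sub>R (V - U)) has_derivative (\<lambda>h. h *\<^sub>R (V - U))) (at \<theta>)"
      by (auto intro!: derivative_eq_intros)
    show "(W has_derivative (\<lambda>h. inner h (gradW (U + \<theta> *\<^sub>R (V - U))))) (at (U + \<theta> *\<^sub>R (V - U)))"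
      using W by (simp add: gderiv_def)
  qed
  then have "((\<lambda>\<theta>. W (U + \<theta> *\<^sub>R (V - U))) has_real_derivative
      inner (V - U) (gradW (U + \<theta> *\<^sub>R (V - U)))) (at \<theta>)" for \<theta>
    by (simp add: has_field_derivative_def mult_commute_abs)
  from MVT2[of 0 1, OF _ this] show ?thesis
    using that by auto
qed

section \<open>Aggregation of agents by class\<close>

lemma UNIV_agent_class: "(UNIV :: agent_class set) = {(High, Rich), (Low, Rich), (High, Poor), (Low, Poor)}"
proof -
  have "q \<in> {(High, Rich), (Low, Rich), (High, Poor), (Low, Poor)}" for q :: agent_class
    by (cases q; cases "fst q"; cases "snd q") auto
  then show ?thesis by blast
qed

lemma sum_by_class:
  fixes c :: "'n::finite \<Rightarrow> agent_class" and g \<phi> :: "_ \<Rightarrow> real"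
  shows "(\<Sum>j\<in>UNIV. g j * \<phi> (c j)) = (\<Sum>q\<in>UNIV. (\<Sum>j | c j = q. g j) * \<phi> q)"
proof -
  have "finite (UNIV :: agent_class set)" by (simp add: UNIV_agent_class)
  then have "(\<Sum>j\<in>UNIV. g j * \<phi> (c j)) = (\<Sum>q\<in>UNIV. \<Sum>j | j \<in> UNIV \<and> c j = q. g j * \<phi> (c j))"
    by (intro sum.group[symmetric]) auto
  also have "\<dots> = (\<Sum>q\<in>UNIV. (\<Sum>j | c j = q. g j) * \<phi> q)"
    by (auto simp: sum_distrib_right intro!: sum.cong)
  finally show ?thesis .
qed

fun by_class :: "'b \<Rightarrow> 'b \<Rightarrow> 'b \<Rightarrow> 'b \<Rightarrow> agent_class \<Rightarrow> 'b" where
  "by_class hr lr hp lp (High, Rich) = hr"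
| "by_class hr lr hp lp (Low, Rich) = lr"
| "by_class hr lr hp lp (High, Poor) = hp"
| "by_class hr lr hp lp (Low, Poor) = lp"

text \<open>The class map and \<rho> are parameters, so that the locale can also be used with the
  labels LR and HP exchanged.\<close>

locale class_network = four_classes +
  fixes c :: "'n::finite \<Rightarrow> agent_class" and G :: "real^'n^'n" and d \<omega> \<rho> :: real
  assumes G_nonneg: "\<And>i j. G $ i $ j \<ge> 0" and G_diag: "\<And>i. G $ i $ i = 0"
    and G_sum: "\<And>i q'. (\<Sum>j | c j = q'. G $ i $ j) = d * link_share \<omega> \<rho> (c i) q'"
    and \<alpha>_eq: "\<alpha> = d * (\<rho> * (1 - \<omega>))" and \<beta>_eq: "\<beta> = d * ((1 - \<rho>) * (1 - \<omega>))"
begin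

definition potential :: "real \<Rightarrow> 'n \<Rightarrow> real" where
  "potential t i = by_class h (h - t) (l + t) l (c i)"

definition consumption :: "real \<Rightarrow> agent_class \<Rightarrow> real" where
  "consumption t = by_class x_top (x_falling t) (x_rising t) (x_bottom t)"

definition utility :: "real \<Rightarrow> agent_class \<Rightarrow> real" where
  "utility t = by_class (u x_top h) (U_falling t) (U_rising t) (U_bottom t)"

lemma network_sum:
  "(\<Sum>j\<in>UNIV. G $ i $ j * \<phi> (c j)) = (\<Sum>q\<in>UNIV. d * link_share \<omega> \<rho> (c i) q * \<phi> q)"
  by (simp only: sum_by_class G_sum)

context
  fixes t
  assumes t: "t \<in> {0..h - l}"
begin

lemma potential_in_Y: "potential t i \<in> Y"
  using potentials_in_Y[OF t] l_Y h_Y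
  by (cases "c i"; cases "fst (c i)"; cases "snd (c i)") (auto simp: potential_def)

text \<open>In each class the terms for its own class and for linked classes consuming no more
  vanish, which leaves the equations defining the class consumptions.\<close>

lemma equilibrium_eq: "equilibrium G F u (potential t) = (\<lambda>i. consumption t (c i))"
proof (rule equilibrium_eqI[OF G_nonneg G_diag potential_in_Y])
  fix i
  show "0 < consumption t (c i) \<and> ux (consumption t (c i)) (potential t i)
      + (\<Sum>j\<in>UNIV. G $ i $ j * p (consumption t (c j) - consumption t (c i))) = 0"
    unfolding network_sum[where \<phi> = "\<lambda>q. p (consumption t q - consumption t (c i))"] potential_def
    using aspiration_pos[OF h_Y] ux_aspiration[OF h_Y] x_pos[OF t] x_falling_foc[OF t] x_rising_foc[OF t]
      x_bottom_foc[OF t] x_falling_bounds[OF t] x_rising_bounds[OF t] x_bottom_le_rising[OF t]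
      x_bottom_le_falling[OF t]
    by (cases "c i"; cases "fst (c i)"; cases "snd (c i)")
      (simp_all add: UNIV_agent_class consumption_def link_share_def p_nonpos \<alpha>_eq[symmetric] \<beta>_eq[symmetric] add.assoc)
qed

lemma payoff_eq: "payoff G F u (potential t) (equilibrium G F u (potential t)) i = utility t (c i)"
proof -
  have "payoff G F u (potential t) (\<lambda>i. consumption t (c i)) i
      = u (consumption t (c i)) (potential t i)
        - (\<Sum>j\<in>UNIV. G $ i $ j * envy (consumption t (c j) - consumption t (c i)))"
    using payoff_update[OF G_diag, where x = "\<lambda>i. consumption t (c i)" and z = "consumption t (c i)" and i = i]
    by (simp add: fun_upd_idem)
  also have "\<dots> = utility t (c i)"
    unfolding network_sum[where \<phi> = "\<lambda>q. envy (consumption t q - consumption t (c i))"] potential_def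
    using x_falling_bounds[OF t] x_rising_bounds[OF t] x_bottom_le_rising[OF t] x_bottom_le_falling[OF t]
    by (cases "c i"; cases "fst (c i)"; cases "snd (c i)")
      (simp_all add: UNIV_agent_class consumption_def utility_def link_share_def F_0 \<alpha>_eq[symmetric] \<beta>_eq[symmetric] max_absorb1
        U_falling_def U_rising_def U_bottom_def add.assoc)
  finally show ?thesis by (simp only: equilibrium_eq)
qed

lemma equilibrium_welfare_eq:
  "equilibrium_welfare W G F u (potential t) = W (\<chi> i. utility t (c i))"
  by (simp add: equilibrium_welfare_def payoff_eq)

end

text \<open>Between two utility profiles the welfare change is a weighted sum of class gains, with
  weights from the gradient at an intermediate profile. The gain of rising outweighs the loss of
  falling by a margin that dominates any loss of bottom.\<close>

lemma equilibrium_welfare_increases: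
  assumes population: "\<And>q. card {i. c i = q} = N" "0 < N"
    and W: "\<And>U. GDERIV W U :> gradW U" and PD: "pigou_dalton W"
    and bounds: "0 < m" "\<And>U i. m \<le> gradW U $ i" "\<And>U i. gradW U $ i \<le> M"
  obtains t\<^sub>0 where "t\<^sub>0 > 0" "t\<^sub>0 \<le> h - l"
    "\<And>t\<^sub>1 t\<^sub>2. 0 \<le> t\<^sub>1 \<Longrightarrow> t\<^sub>1 < t\<^sub>2 \<Longrightarrow> t\<^sub>2 < t\<^sub>0 \<Longrightarrow>
      equilibrium_welfare W G F u (potential t\<^sub>1) < equilibrium_welfare W G F u (potential t\<^sub>2)"
proof -
  obtain K1 K2 ta where K: "0 \<le> K1" "K1 < K2" and ta: "ta > 0" "ta \<le> h - l"
    "\<And>t\<^sub>1 t\<^sub>2. 0 \<le> t\<^sub>1 \<Longrightarrow> t\<^sub>1 \<le> t\<^sub>2 \<Longrightarrow> t\<^sub>2 < ta \<Longrightarrow> - K1 * (t\<^sub>2 - t\<^sub>1) \<le> U_falling t\<^sub>2 - U_falling t\<^sub>1"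
    "\<And>t\<^sub>1 t\<^sub>2. 0 \<le> t\<^sub>1 \<Longrightarrow> t\<^sub>1 \<le> t\<^sub>2 \<Longrightarrow> t\<^sub>2 < ta \<Longrightarrow> K2 * (t\<^sub>2 - t\<^sub>1) \<le> U_rising t\<^sub>2 - U_rising t\<^sub>1"
    by (rule U_falling_rising_growth) blast
  obtain tb where tb: "tb > 0" "\<And>t. t \<in> {0..h - l} \<Longrightarrow> t < tb \<Longrightarrow> U_rising t < U_falling t"
    by (rule U_rising_less_falling) blast
  have "0 < M" using bounds order.strict_trans2 order_trans by metis
  \<comment> \<open>Chosen so that the largest possible loss of bottom, with weights at most M,
    stays below the surplus K2 - K1 with weights at least m.\<close>
  define \<epsilon> where "\<epsilon> = m * (K2 - K1) / (2 * M)"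
  have \<epsilon>: "\<epsilon> > 0" "M * \<epsilon> < m * (K2 - K1)"
    using bounds(1) K \<open>0 < M\<close> by (auto simp: \<epsilon>_def)
  obtain tc where tc: "tc > 0" "tc \<le> h - l"
    "\<And>t\<^sub>1 t\<^sub>2. 0 \<le> t\<^sub>1 \<Longrightarrow> t\<^sub>1 \<le> t\<^sub>2 \<Longrightarrow> t\<^sub>2 < tc \<Longrightarrow> - \<epsilon> * (t\<^sub>2 - t\<^sub>1) \<le> U_bottom t\<^sub>2 - U_bottom t\<^sub>1"
    by (rule U_bottom_growth[OF \<epsilon>(1)]) blast
  show ?thesis
  proof
    show "min ta (min tb tc) > 0" "min ta (min tb tc) \<le> h - l"
      using ta tb tc by auto
    fix t\<^sub>1 t\<^sub>2 assume *: "0 \<le> t\<^sub>1" "t\<^sub>1 < t\<^sub>2" "t\<^sub>2 < min ta (min tb tc)"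
    have t: "t\<^sub>1 \<in> {0..h - l}" "t\<^sub>2 \<in> {0..h - l}" using * ta(2) by auto
    define U where "U t = (\<chi> i. utility t (c i))" for t
    obtain \<theta> where \<theta>: "0 < \<theta>" "\<theta> < 1"
      "W (U t\<^sub>2) - W (U t\<^sub>1) = inner (U t\<^sub>2 - U t\<^sub>1) (gradW (U t\<^sub>1 + \<theta> *\<^sub>R (U t\<^sub>2 - U t\<^sub>1)))"
      using GDERIV_mvt[OF W] by blast
    define Z where "Z = U t\<^sub>1 + \<theta> *\<^sub>R (U t\<^sub>2 - U t\<^sub>1)"
    define S where "S q = (\<Sum>i | c i = q. gradW Z $ i)" for q
    have S_bounds: "N * m \<le> S q" "S q \<le> N * M" for q
      using sum_bounded_below[of "{i. c i = q}" m "\<lambda>i. gradW Z $ i"]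
        sum_bounded_above[of "{i. c i = q}" "\<lambda>i. gradW Z $ i" M] bounds population(1)
      by (auto simp: S_def)
    have S_le: "S (Low, Rich) \<le> S (High, Poor)"
    proof -
      \<comment> \<open>Equal class sizes allow each falling agent to be paired with a rising one,
        so the derivatives can be compared one by one.\<close>
      obtain f where f: "bij_betw f {i. c i = (Low, Rich)} {i. c i = (High, Poor)}"
        using finite_same_card_bij[of "{i. c i = (Low, Rich)}" "{i. c i = (High, Poor)}"]
        by (auto simp: population(1))
      have "gradW Z $ i \<le> gradW Z $ f i" if "c i = (Low, Rich)" for i
      proof (rule pigou_dalton_gradient[OF PD W])
        have "c (f i) = (High, Poor)"
          using f that by (auto dest: bij_betwE)
        \<comment> \<open>Rising is worse off than falling at both profiles, hence also at their
          convex combination Z.\<close>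
        moreover have "(1 - \<theta>) * U_rising t\<^sub>1 + \<theta> * U_rising t\<^sub>2 < (1 - \<theta>) * U_falling t\<^sub>1 + \<theta> * U_falling t\<^sub>2"
          using tb(2)[OF t(1)] tb(2)[OF t(2)] * \<theta> by (intro add_strict_mono mult_strict_left_mono) auto
        ultimately show "Z $ f i < Z $ i"
          using that by (simp add: Z_def U_def utility_def algebra_simps)
      qed
      then have "S (Low, Rich) \<le> (\<Sum>i | c i = (Low, Rich). gradW Z $ f i)"
        unfolding S_def by (intro sum_mono) auto
      also have "\<dots> = S (High, Poor)"
        unfolding S_def by (rule sum.reindex_bij_betw[OF f])
      finally show ?thesis .
    qed
    let ?\<tau> = "t\<^sub>2 - t\<^sub>1"
    have "W (U t\<^sub>2) - W (U t\<^sub>1) = (\<Sum>i\<in>UNIV. gradW Z $ i * (utility t\<^sub>2 (c i) - utility t\<^sub>1 (c i)))"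
      unfolding \<theta>(3) Z_def[symmetric] by (simp add: inner_vec_def U_def mult.commute)
    also have "\<dots> = (\<Sum>q\<in>UNIV. S q * (utility t\<^sub>2 q - utility t\<^sub>1 q))"
      unfolding S_def by (rule sum_by_class)
    also have "\<dots> = S (Low, Rich) * (U_falling t\<^sub>2 - U_falling t\<^sub>1)
        + S (High, Poor) * (U_rising t\<^sub>2 - U_rising t\<^sub>1) + S (Low, Poor) * (U_bottom t\<^sub>2 - U_bottom t\<^sub>1)"
      by (simp add: UNIV_agent_class utility_def)
    finally have diff: "W (U t\<^sub>2) - W (U t\<^sub>1) = \<dots>" .
    have S_nonneg: "0 \<le> S q" for q
      using S_bounds(1)[of q] bounds(1) by (smt (verit) mult_nonneg_nonneg of_nat_0_le_iff)
    \<comment> \<open>The gain of rising is split as K1 + (K2 - K1): the first part pays for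
      falling, as its weight is no larger, and the rest exceeds the loss of bottom.\<close>
    have "S (Low, Rich) * (- K1 * ?\<tau>) \<le> S (Low, Rich) * (U_falling t\<^sub>2 - U_falling t\<^sub>1)"
      using ta(3)[of t\<^sub>1 t\<^sub>2] * S_nonneg by (intro mult_left_mono) auto
    moreover have "S (Low, Rich) * (K1 * ?\<tau>) \<le> S (High, Poor) * (K1 * ?\<tau>)"
      using S_le K * by (intro mult_right_mono) auto
    moreover have "S (High, Poor) * (K2 * ?\<tau>) \<le> S (High, Poor) * (U_rising t\<^sub>2 - U_rising t\<^sub>1)"
      using ta(4)[of t\<^sub>1 t\<^sub>2] * S_nonneg by (intro mult_left_mono) auto
    moreover have "S (Low, Poor) * (- \<epsilon> * ?\<tau>) \<le> S (Low, Poor) * (U_bottom t\<^sub>2 - U_bottom t\<^sub>1)"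
      using tc(3)[of t\<^sub>1 t\<^sub>2] * S_nonneg by (intro mult_left_mono) auto
    moreover have "S (Low, Poor) * (\<epsilon> * ?\<tau>) \<le> N * M * (\<epsilon> * ?\<tau>)"
      using S_bounds(2) \<epsilon>(1) * by (intro mult_right_mono) auto
    moreover have "N * m * ((K2 - K1) * ?\<tau>) \<le> S (High, Poor) * ((K2 - K1) * ?\<tau>)"
      using S_bounds(1) K * by (intro mult_right_mono) auto
    moreover have "N * M * (\<epsilon> * ?\<tau>) < N * m * ((K2 - K1) * ?\<tau>)"
    proof -
      have "(N * ?\<tau>) * (M * \<epsilon>) < (N * ?\<tau>) * (m * (K2 - K1))"
        using \<epsilon>(2) * population(2) by (intro mult_strict_left_mono) auto
      then show ?thesis by (simp only: mult_ac)
    qed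
    ultimately have "0 < W (U t\<^sub>2) - W (U t\<^sub>1)"
      unfolding diff by (simp add: algebra_simps)
    then show "equilibrium_welfare W G F u (potential t\<^sub>1) < equilibrium_welfare W G F u (potential t\<^sub>2)"
      by (simp add: equilibrium_welfare_eq[OF t(1)] equilibrium_welfare_eq[OF t(2)] U_def)
  qed
qed

end

section \<open>Exchange of the roles of ability and background\<close>

definition swap_middle :: "agent_class \<Rightarrow> agent_class" where
  "swap_middle = by_class (High, Rich) (High, Poor) (Low, Rich) (Low, Poor)"

lemma agent_class_cases:
  obtains "q = (High, Rich)" | "q = (Low, Rich)" | "q = (High, Poor)" | "q = (Low, Poor)"
  using UNIV_I[of q] unfolding UNIV_agent_class by blast

lemma swap_middle_eq_iff: "swap_middle q = q' \<longleftrightarrow> q = swap_middle q'"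
  by (cases q rule: agent_class_cases; cases q' rule: agent_class_cases) (simp_all add: swap_middle_def)

text \<open>The exchange turns same-ability links into same-background links, which amounts to
  replacing \<rho> by 1 - \<rho>; being an involution, it can be moved to the other
  argument.\<close>

lemma link_share_swap_middle:
  "link_share \<omega> (1 - \<rho>) (swap_middle q) q' = link_share \<omega> \<rho> q (swap_middle q')"
  by (cases q rule: agent_class_cases; cases q' rule: agent_class_cases)
    (simp_all add: swap_middle_def link_share_def)

section \<open>Earning potentials and the two ends of the mobility range\<close>

theorem proposition2:
  fixes c :: "'n::finite \<Rightarrow> agent_class"
    and y :: "agent_class \<Rightarrow> real \<Rightarrow> real"
    and G :: "real^'n^'n"
    and d \<omega> \<rho> :: real
    and F :: "real \<Rightarrow> real"
    and Y :: "real set"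
    and u u\<^sub>x u\<^sub>y u\<^sub>x\<^sub>x u\<^sub>x\<^sub>y u\<^sub>y\<^sub>x u\<^sub>y\<^sub>y :: "real \<Rightarrow> real \<Rightarrow> real"
    and W :: "real^'n \<Rightarrow> real"
    and gradW :: "real^'n \<Rightarrow> real^'n"
  assumes population: "4 dvd CARD('n)" "\<And>q. card {i. c i = q} = CARD('n) div 4"
    and y_cont: "\<And>q. continuous_on {0..1} (y q)"
    and y_diff: "\<And>q s. s \<in> {0<..<1} \<Longrightarrow> y q differentiable (at s)"
    and y_deriv:
      "\<And>s. s \<in> {0<..<1} \<Longrightarrow> deriv (y (High, Poor)) s = - deriv (y (Low, Rich)) s"
      "\<And>s. s \<in> {0<..<1} \<Longrightarrow> deriv (y (High, Poor)) s > 0"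
      "\<And>s. s \<in> {0<..<1} \<Longrightarrow> deriv (y (High, Rich)) s = 0"
      "\<And>s. s \<in> {0<..<1} \<Longrightarrow> deriv (y (Low, Poor)) s = 0"
    and y_ability:
      "\<And>b s. s \<in> {0<..<1} \<Longrightarrow> y (High, b) s > y (Low, b) s"
      "\<And>b. ((\<lambda>s. y (High, b) s - y (Low, b) s) \<longlongrightarrow> 0) (at_right 0)"
    and y_background:
      "\<And>a s. s \<in> {0<..<1} \<Longrightarrow> y (a, Rich) s > y (a, Poor) s"
      "\<And>a. ((\<lambda>s. y (a, Rich) s - y (a, Poor) s) \<longlongrightarrow> 0) (at_left 1)"
    and network: "\<And>i j. G $ i $ j \<ge> 0" "\<And>i. G $ i $ i = 0"
      "d > 0" "\<omega> \<in> {0<..<1}" "\<rho> \<in> {0<..<1}"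
      "\<And>i q'. (\<Sum>j | c j = q'. G $ i $ j) = d * link_share \<omega> \<rho> (c i) q'"
    and F: "smooth_on_nonneg F" "strict_mono_on {0..} F" "strictly_convex_on {0..} F"
      "F 0 = 0" "(F has_real_derivative 0) (at 0 within {0..})"
    and Y: "open Y" "is_interval Y" "\<And>q s. s \<in> {0..1} \<Longrightarrow> y q s \<in> Y"
    and u_C2: "C1_partials_on ({0..} \<times> Y) u u\<^sub>x u\<^sub>y"
      "C1_partials_on ({0..} \<times> Y) u\<^sub>x u\<^sub>x\<^sub>x u\<^sub>x\<^sub>y"
      "C1_partials_on ({0..} \<times> Y) u\<^sub>y u\<^sub>y\<^sub>x u\<^sub>y\<^sub>y"
    and u_xx: "\<And>x \<eta>. x \<ge> 0 \<Longrightarrow> \<eta> \<in> Y \<Longrightarrow> u\<^sub>x\<^sub>x x \<eta> < 0"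
    and argmax_interior:
      "\<And>\<eta>. \<eta> \<in> Y \<Longrightarrow> \<exists>x>0. is_arg_max (\<lambda>x. u x \<eta>) (\<lambda>x. x \<ge> 0) x"
    and u_y: "\<And>x \<eta>. x \<ge> 0 \<Longrightarrow> \<eta> \<in> Y \<Longrightarrow> u\<^sub>y x \<eta> > 0"
    and u_xy: "\<And>x \<eta>. x > 0 \<Longrightarrow> \<eta> \<in> Y \<Longrightarrow> u\<^sub>x\<^sub>y x \<eta> > 0"
    and V_concave: "strictly_concave_on Y (indirect_utility u)"
    and W_C1: "\<And>U. GDERIV W U :> gradW U" "continuous_on UNIV gradW"
    and W_increasing: "\<And>U i \<epsilon>. \<epsilon> > 0 \<Longrightarrow> W U < W (U + axis i \<epsilon>)"
    and W_bounds: "\<exists>m M. 0 < m \<and> m \<le> M \<and> (\<forall>U i. m \<le> gradW U $ i \<and> gradW U $ i \<le> M)"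
    and W_PD: "pigou_dalton W"
  shows "(\<exists>s\<^sub>0\<in>{0<..<1}. strict_mono_on {0<..<s\<^sub>0}
            (\<lambda>s. equilibrium_welfare W G F u (\<lambda>i. y (c i) s)))
       \<and> (\<exists>s\<^sub>1\<in>{0<..<1}. strict_antimono_on {s\<^sub>1<..<1}
            (\<lambda>s. equilibrium_welfare W G F u (\<lambda>i. y (c i) s)))"
proof -
  obtain p where p: "\<And>r. ((\<lambda>r. F (max 0 r)) has_real_derivative p r) (at r)" "mono p"
    "\<And>r. r \<le> 0 \<Longrightarrow> p r = 0"
    "\<And>B. \<exists>L\<ge>0. \<forall>r s. r \<le> s \<longrightarrow> s \<le> B \<longrightarrow> p s - p r \<le> L * (s - r)"
    using penalty_derivative_exists[OF F] by blast
  obtain m M where bounds: "0 < m" "\<And>U i. m \<le> gradW U $ i" "\<And>U i. gradW U $ i \<le> M"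
    using W_bounds by blast
  define N where "N = CARD('n) div 4"
  have N: "0 < N" using dvd_imp_le[OF population(1) zero_less_card_finite] by (simp add: N_def div_greater_zero_iff)
  let ?EW = "\<lambda>s. equilibrium_welfare W G F u (\<lambda>i. y (c i) s)"

  have DERIV_y: "(y q has_real_derivative deriv (y q) s) (at s)" if "s \<in> {0<..<1}" for q s
    using y_diff[OF that] by (simp add: DERIV_deriv_iff_real_differentiable)
  have const: "f s = f 0" if "continuous_on {0..1} f" "\<And>s. s \<in> {0<..<1} \<Longrightarrow> (f has_real_derivative 0) (at s)"
    "s \<in> {0..1}" for f :: "real \<Rightarrow> real" and s
    using DERIV_isconst2[of 0 1 f s] that by auto
  define h l where "h = y (High, Rich) 0" and "l = y (Low, Poor) 0"
  have HR: "y (High, Rich) s = h" if "s \<in> {0..1}" for s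
    unfolding h_def by (rule const[OF y_cont _ that]) (use DERIV_y y_deriv(3) in metis)
  have LP: "y (Low, Poor) s = l" if "s \<in> {0..1}" for s
    unfolding l_def by (rule const[OF y_cont _ that]) (use DERIV_y y_deriv(4) in metis)
  \<comment> \<open>Continuity turns the limit assumptions into equalities of potentials at the
    endpoints 0 and 1.\<close>
  have at_0: "y q 0 = y q' 0" if "((\<lambda>s. y q s - y q' s) \<longlongrightarrow> 0) (at_right 0)" for q q'
  proof -
    have "((\<lambda>s. y q s - y q' s) \<longlongrightarrow> y q 0 - y q' 0) (at_right 0)"
      by (rule continuous_on_Icc_at_rightD[of 0 1]) (auto intro!: continuous_intros y_cont)
    then show ?thesis using tendsto_unique[OF _ that] by fastforce
  qed
  have at_1: "y q 1 = y q' 1" if "((\<lambda>s. y q s - y q' s) \<longlongrightarrow> 0) (at_left 1)" for q q'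
  proof -
    have "((\<lambda>s. y q s - y q' s) \<longlongrightarrow> y q 1 - y q' 1) (at_left 1)"
      by (rule continuous_on_Icc_at_leftD[of 0 1]) (auto intro!: continuous_intros y_cont)
    then show ?thesis using tendsto_unique[OF _ that] by fastforce
  qed
  have HP_0: "y (High, Poor) 0 = l" and LR_0: "y (Low, Rich) 0 = h"
    using at_0[OF y_ability(2)] by (auto simp: h_def l_def)
  have LR_1: "y (Low, Rich) 1 = l"
    using at_1[OF y_background(2)] LP[of 1] by auto
  \<comment> \<open>The opposite derivatives of HP and LR make their sum constant, so a single
    parameter describes all four potentials.\<close>
  have sum_eq: "y (High, Poor) s + y (Low, Rich) s = l + h" if "s \<in> {0..1}" for s
  proof -
    have "y (High, Poor) s + y (Low, Rich) s = y (High, Poor) 0 + y (Low, Rich) 0"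
    proof (rule const[OF _ _ that])
      show "((\<lambda>s. y (High, Poor) s + y (Low, Rich) s) has_real_derivative 0) (at s)"
        if "s \<in> {0<..<1}" for s
        using DERIV_add[OF DERIV_y DERIV_y, OF that that, of "(High, Poor)" "(Low, Rich)"] y_deriv(1)[OF that]
        by simp
    qed (intro continuous_intros y_cont)
    then show ?thesis by (simp add: HP_0 LR_0)
  qed
  have HP_less: "y (High, Poor) s < y (High, Poor) s'" if "0 \<le> s" "s < s'" "s' \<le> 1" for s s'
  proof (rule DERIV_pos_imp_increasing_open[OF \<open>s < s'\<close>])
    show "continuous_on {s..s'} (y (High, Poor))"
      by (rule continuous_on_subset[OF y_cont]) (use that in auto)
    show "\<exists>z. (y (High, Poor) has_real_derivative z) (at x) \<and> 0 < z" if "s < x" "x < s'" for x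
      using DERIV_y y_deriv(2) that \<open>0 \<le> s\<close> \<open>s' \<le> 1\<close> by (intro exI[of _ "deriv (y (High, Poor)) x"] conjI) auto
  qed
  have "l < h" using HP_less[of 0 1] HP_0 sum_eq[of 1] LR_1 by simp
  have lh_Y: "l \<in> Y" "h \<in> Y" using Y(3)[of 0] by (auto simp: h_def l_def)

  interpret status_game Y u u\<^sub>x u\<^sub>y u\<^sub>x\<^sub>x u\<^sub>x\<^sub>y F p
    by unfold_locales (use Y u_C2 u_xx argmax_interior u_y u_xy V_concave F(4) p in blast)+
  have links: "0 \<le> d * (\<rho> * (1 - \<omega>))" "0 \<le> d * ((1 - \<rho>) * (1 - \<omega>))"
    using network by auto

  \<comment> \<open>Near mobility 0, HP is the rising class and LR the falling one, with t =
    \<open>y (High, Poor) s - l\<close> increasing in s and tending to 0.\<close>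
  interpret A: class_network Y u u\<^sub>x u\<^sub>y u\<^sub>x\<^sub>x u\<^sub>x\<^sub>y F p l h
    "d * (\<rho> * (1 - \<omega>))" "d * ((1 - \<rho>) * (1 - \<omega>))" c G d \<omega> \<rho>
    by unfold_locales (use lh_Y \<open>l < h\<close> links network in auto)
  have EW_A: "?EW s = equilibrium_welfare W G F u (A.potential (y (High, Poor) s - l))"
    if "s \<in> {0<..<1}" for s
  proof -
    have "y (c i) s = A.potential (y (High, Poor) s - l) i" for i
      unfolding A.potential_def using that HR[of s] LP[of s] sum_eq[of s]
      by (cases "c i" rule: agent_class_cases) auto
    then show ?thesis by simp
  qed
  obtain ta where ta: "ta > 0" "\<And>t\<^sub>1 t\<^sub>2. 0 \<le> t\<^sub>1 \<Longrightarrow> t\<^sub>1 < t\<^sub>2 \<Longrightarrow> t\<^sub>2 < ta \<Longrightarrow>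
      equilibrium_welfare W G F u (A.potential t\<^sub>1) < equilibrium_welfare W G F u (A.potential t\<^sub>2)"
    by (rule A.equilibrium_welfare_increases[OF population(2)[folded N_def] N W_C1(1) W_PD bounds]) blast
  have "(y (High, Poor) \<longlongrightarrow> l) (at_right 0)"
    using continuous_on_Icc_at_rightD[OF y_cont[of "(High, Poor)"]] HP_0 by simp
  then have "\<forall>\<^sub>F s in at_right 0. y (High, Poor) s < l + ta"
    by (rule order_tendstoD) (use ta in simp)
  then obtain b where b: "b > 0" "\<And>s. 0 < s \<Longrightarrow> s < b \<Longrightarrow> y (High, Poor) s < l + ta"
    unfolding eventually_at_right_field by blast
  \<comment> \<open>The cap 1/2 keeps the witness inside the open unit interval.\<close>
  have incr: "strict_mono_on {0<..<min b (1/2)} ?EW"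
  proof (rule strict_mono_onI)
    fix s s' assume s: "s \<in> {0<..<min b (1/2)}" "s' \<in> {0<..<min b (1/2)}" "s < s'"
    then have "0 \<le> y (High, Poor) s - l" "y (High, Poor) s - l < y (High, Poor) s' - l"
      "y (High, Poor) s' - l < ta"
      using HP_less[of 0 s] HP_less[of s s'] HP_0 b(2)[of s'] by auto
    from ta(2)[OF this] show "?EW s < ?EW s'"
      using s by (simp add: EW_A)
  qed

  have swap_class: "{i. swap_middle (c i) = q} = {i. c i = swap_middle q}" for q
    by (simp add: swap_middle_eq_iff)
  \<comment> \<open>Near mobility 1 the roles are exchanged: t = \<open>y (Low, Rich) s - l\<close>
    tends to 0 but decreases in s, so growth of welfare in t becomes decline in s.\<close>
  interpret B: class_network Y u u\<^sub>x u\<^sub>y u\<^sub>x\<^sub>x u\<^sub>x\<^sub>y F p l h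
    "d * ((1 - \<rho>) * (1 - \<omega>))" "d * (\<rho> * (1 - \<omega>))" "swap_middle \<circ> c" G d \<omega> "1 - \<rho>"
    by unfold_locales
      (use lh_Y \<open>l < h\<close> links network(1,2,6) in \<open>auto simp: swap_class link_share_swap_middle\<close>)
  have EW_B: "?EW s = equilibrium_welfare W G F u (B.potential (y (Low, Rich) s - l))"
    if "s \<in> {0<..<1}" for s
  proof -
    have "y (c i) s = B.potential (y (Low, Rich) s - l) i" for i
      unfolding B.potential_def using that HR[of s] LP[of s] sum_eq[of s]
      by (cases "c i" rule: agent_class_cases) (auto simp: swap_middle_def)
    then show ?thesis by simp
  qed
  have card_swap: "card {i. (swap_middle \<circ> c) i = q} = N" for q
    using population(2) by (simp add: swap_class N_def)
  obtain tb where tb: "tb > 0" "\<And>t\<^sub>1 t\<^sub>2. 0 \<le> t\<^sub>1 \<Longrightarrow> t\<^sub>1 < t\<^sub>2 \<Longrightarrow> t\<^sub>2 < tb \<Longrightarrow>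
      equilibrium_welfare W G F u (B.potential t\<^sub>1) < equilibrium_welfare W G F u (B.potential t\<^sub>2)"
    by (rule B.equilibrium_welfare_increases[OF card_swap N W_C1(1) W_PD bounds]) blast
  have "(y (Low, Rich) \<longlongrightarrow> l) (at_left 1)"
    using continuous_on_Icc_at_leftD[OF y_cont[of "(Low, Rich)"]] LR_1 by simp
  then have "\<forall>\<^sub>F s in at_left 1. y (Low, Rich) s < l + tb"
    by (rule order_tendstoD) (use tb in simp)
  then obtain b' where b': "b' < 1" "\<And>s. b' < s \<Longrightarrow> s < 1 \<Longrightarrow> y (Low, Rich) s < l + tb"
    unfolding eventually_at_left_field by blast
  have decr: "strict_antimono_on {max b' (1/2)<..<1} ?EW"
  proof (rule monotone_onI)
    fix s s' assume s: "s \<in> {max b' (1/2)<..<1}" "s' \<in> {max b' (1/2)<..<1}" "s < s'"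
    then have "0 \<le> y (Low, Rich) s' - l" "y (Low, Rich) s' - l < y (Low, Rich) s - l"
      "y (Low, Rich) s - l < tb"
      using HP_less[of s' 1] HP_less[of s s'] sum_eq[of s] sum_eq[of s'] sum_eq[of 1] LR_1 b'(2)[of s]
      by auto
    from tb(2)[OF this] show "?EW s > ?EW s'"
      using s by (simp add: EW_B)
  qed
  show ?thesis
    using incr decr b(1) b'(1) by (intro conjI bexI[of _ "min b (1/2)"] bexI[of _ "max b' (1/2)"]) auto
qed

end
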